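(* Let $(\mathfrak X,d)$ be a separable and complete CC space, let $X,Y$ be integrable $\mathfrak X$-valued random elements, and let $\mathcal G$ be a sub-$\sigma$-algebra of $\mathcal F$. Then the following hold almost surely: 1) $E(E(X|\mathcal G))=EX$. 2) If $\sigma(X)$ and $\mathcal G$ are independent then $E(X|\mathcal G)=EX$. 3) If $X$ is $\mathcal G$-measurable then $E(X|\mathcal G)=KX$. 4) If $\xi$ is a real-valued random variable with $0<\xi<1$ and $\xi$ is $\mathcal G$-measurable, then $E([\xi,X;1-\xi,Y]|\mathcal G)=[\xi,E(X|\mathcal G);1-\xi,E(Y|\mathcal G)]$. In particular, $E([\lambda,X;1-\lambda,Y]|\mathcal G)=[\lambda,E(X|\mathcal G);1-\lambda,E(Y|\mathcal G)]$ for $\lambda\in(0,1)$. 5) If $\mathcal G_1,\mathcal G_2$ are two sub-$\sigma$-algebras of $\mathcal F$ and $\mathcal G_1\subset\mathcal G_2$, then $E(E(X|\mathcal G_1)|\mathcal G_2)=E(E(X|\mathcal G_2)|\mathcal G_1)=E(X|\mathcal G_1)$.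
   Context: A convex combination space (CC space) is a metric space $(\mathfrak X,d)$ endowed with a convex combination operation, which to all $n\ge1$, all $\lambda_1,\dots,\lambda_n>0$ with $\sum_{i=1}^n\lambda_i=1$ and all $u_1,\dots,u_n\in\mathfrak X$ assigns an element $[\lambda_1,u_1;\dots;\lambda_n,u_n]=[\lambda_i,u_i]_{i=1}^n$ of $\mathfrak X$, with $[1,u]=u$, and such that: (CC.i) $[\lambda_i,u_i]_{i=1}^n=[\lambda_{\sigma(i)},u_{\sigma(i)}]_{i=1}^n$ for every permutation $\sigma$ of $\{1,\dots,n\}$; (CC.ii) $[\lambda_i,u_i]_{i=1}^{n+2}=\big[\lambda_1,u_1;\dots;\lambda_n,u_n;\lambda_{n+1}+\lambda_{n+2},\big[\tfrac{\lambda_{n+j}}{\lambda_{n+1}+\lambda_{n+2}},u_{n+j}\big]_{j=1}^2\big]$; (CC.iii) if $u,v\in\mathfrak X$ and $\lambda^{(k)}\to\lambda\in(0,1)$ then $[\lambda^{(k)},u;1-\lambda^{(k)},v]\to[\lambda,u;1-\lambda,v]$; (CC.iv) for $u_1,u_2,v_1,v_2\in\mathfrak X$ and $\lambda\in(0,1)$, $d([\lambda,u_1;1-\lambda,u_2],[\lambda,v_1;1-\lambda,v_2])\le\lambda d(u_1,v_1)+(1-\lambda)d(u_2,v_2)$; (CC.v) for each $u\in\mathfrak X$ the limit $Ku:=\lim_{n\to\infty}[n^{-1},u]_{i=1}^n$ exists in $\mathfrak X$; $K$ is called the convexification operator. Write $K(\mathfrak X)=\{Ku:u\in\mathfrak X\}$;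 $K$ is idempotent. For points of $K(\mathfrak X)$, weights in $[0,1]$ are allowed by discarding entries with weight $0$. $(\Omega,\mathcal F,P)$ is a complete probability space without atoms. A map $X:\Omega\to\mathfrak X$ is $\mathcal G$-measurable if preimages of Borel sets lie in $\mathcal G$; a random element is an $\mathcal F$-measurable map; it is integrable if $d(u,X)$ is integrable for some (equivalently every) $u\in\mathfrak X$. $\sigma(X)$ is the $\sigma$-algebra generated by $X$. Convex combinations of random elements are taken pointwise. A simple random element takes finitely many values; if $X=x_i$ on $\Omega_i$, where $\Omega_1,\dots,\Omega_n$ is a measurable partition of $\Omega$, write $X=[I_{\Omega_i},x_i]_{i=1}^n$ and define $EX=[P(\Omega_i),Kx_i]_{i=1}^n$ and, for a sub-$\sigma$-algebra $\mathcal G\subset\mathcal F$, $E(X|\mathcal G)=[E(I_{\Omega_i}|\mathcal G),Kx_i]_{i=1}^n$. For integrable $X$: fix $u_0\in K(\mathfrak X)$ and a countable dense set $\{u_j:j\ge1\}\subset\mathfrak X$, let $\psi_n(x)=u_{m_n(x)}$, where $m_n(x)$ is the smallest $i\in\{0,\dots,n\}$ with $d(u_i,x)=\min_{0\le j\le n}d(u_j,x)$, and define the expectation $EX=\lim_{n\to\infty}E\psi_n(X)$ and the conditional expectation $E(X|\mathcal G)=\lim_{n\to\infty}E(\psi_n(X)|\mathcal G)$ a.s. (up to a null set); these limits exist, and $E(X|\mathcal G)$ is an integrable, $\mathcal G$-measurable, $K(\mathfrak X)$-valued random element. *)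

theory Defs
  imports "HOL-Probability.Probability" "HOL-Combinatorics.Permutations"
begin

section \<open>Convex combination spaces\<close>

text \<open>
  A convex combination \<open>[\<lambda>\<^sub>1, u\<^sub>1; \<dots>; \<lambda>\<^sub>n, u\<^sub>n]\<close> is written \<open>cc [(\<lambda>\<^sub>1, u\<^sub>1), \<dots>, (\<lambda>\<^sub>n, u\<^sub>n)]\<close>. Only lists
  whose weights are positive and sum to 1 (in particular only non-empty lists) are meaningful;
  on all other lists the value of \<open>cc\<close> is unspecified.
\<close>

definition cc_weights :: "(real \<times> 'a) list \<Rightarrow> bool" where
  "cc_weights ws \<longleftrightarrow> (\<forall>(l, u) \<in> set ws. 0 < l) \<and> sum_list (map fst ws) = 1"

definition cc_convexify :: "((real \<times> 'a::metric_space) list \<Rightarrow> 'a) \<Rightarrow> 'a \<Rightarrow> 'a" where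
  "cc_convexify cc u = lim (\<lambda>n. cc (replicate (Suc n) (1 / real (Suc n), u)))"

locale cc_space =
  fixes cc :: "(real \<times> 'a::metric_space) list \<Rightarrow> 'a"
  assumes cc_single: "cc [(1, u)] = u"
    and cc_permute: "cc_weights ws \<Longrightarrow> \<sigma> permutes {..<length ws} \<Longrightarrow> cc (permute_list \<sigma> ws) = cc ws"
    and cc_merge: "cc_weights (ws @ [(a, u), (b, v)]) \<Longrightarrow>
          cc (ws @ [(a, u), (b, v)]) = cc (ws @ [(a + b, cc [(a / (a + b), u), (b / (a + b), v)])])"
    and cc_continuous: "(\<And>k. 0 < ls k \<and> ls k < 1) \<Longrightarrow> 0 < l \<Longrightarrow> l < 1 \<Longrightarrow> ls \<longlonglongrightarrow> l \<Longrightarrow>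
          (\<lambda>k. cc [(ls k, u), (1 - ls k, v)]) \<longlonglongrightarrow> cc [(l, u), (1 - l, v)]"
    and cc_dist: "0 < l \<Longrightarrow> l < 1 \<Longrightarrow>
          dist (cc [(l, u\<^sub>1), (1 - l, u\<^sub>2)]) (cc [(l, v\<^sub>1), (1 - l, v\<^sub>2)]) \<le> l * dist u\<^sub>1 v\<^sub>1 + (1 - l) * dist u\<^sub>2 v\<^sub>2"
    and cc_convexifiable: "convergent (\<lambda>n. cc (replicate (Suc n) (1 / real (Suc n), u)))"

text \<open>Weights in \<open>[0, 1]\<close>, for points in the range of \<^term>\<open>cc_convexify cc\<close>.\<close>

definition cc0 :: "((real \<times> 'a) list \<Rightarrow> 'a) \<Rightarrow> (real \<times> 'a) list \<Rightarrow> 'a" where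
  "cc0 cc ws = cc (filter (\<lambda>(l, u). l \<noteq> 0) ws)"

section \<open>Probability\<close>

definition atomless :: "'w measure \<Rightarrow> bool" where
  "atomless M \<longleftrightarrow> (\<forall>A \<in> sets M. 0 < measure M A \<longrightarrow>
     (\<exists>B \<in> sets M. B \<subseteq> A \<and> 0 < measure M B \<and> measure M B < measure M A))"

definition cc_integrable :: "'w measure \<Rightarrow> ('w \<Rightarrow> 'a::metric_space) \<Rightarrow> bool" where
  "cc_integrable M X \<longleftrightarrow> X \<in> borel_measurable M \<and> (\<exists>u. integrable M (\<lambda>\<omega>. dist u (X \<omega>)))"

text \<open>
  A simple random element is represented by the partition into its level sets. The order in which
  its values are listed is immaterial because \<open>cc\<close> is permutation invariant.
\<close>

definition simple_values :: "'w measure \<Rightarrow> ('w \<Rightarrow> 'a) \<Rightarrow> 'a list" where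
  "simple_values M X = (SOME xs. distinct xs \<and> set xs = X ` space M)"

definition simple_expectation ::
    "((real \<times> 'a::metric_space) list \<Rightarrow> 'a) \<Rightarrow> 'w measure \<Rightarrow> ('w \<Rightarrow> 'a) \<Rightarrow> 'a" where
  "simple_expectation cc M X =
     cc0 cc (map (\<lambda>x. (measure M (X -` {x} \<inter> space M), cc_convexify cc x)) (simple_values M X))"

text \<open>
  The versions of \<open>P(X = x | G)\<close> given by \<^const>\<open>real_cond_exp\<close> are non-negative and sum to 1 only
  almost surely; on the exceptional null set, which belongs to \<open>G\<close>, the value is set to a constant \<open>c\<close>.
\<close>

definition simple_cond_expectation ::
    "((real \<times> 'a::metric_space) list \<Rightarrow> 'a) \<Rightarrow> 'a \<Rightarrow> 'w measure \<Rightarrow> 'w measure \<Rightarrow> ('w \<Rightarrow> 'a) \<Rightarrow> 'w \<Rightarrow> 'a" where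
  "simple_cond_expectation cc c M G X \<omega> =
     (let ws = map (\<lambda>x. (real_cond_exp M G (indicator (X -` {x} \<inter> space M)) \<omega>, cc_convexify cc x))
                 (simple_values M X)
      in if (\<forall>(l, u) \<in> set ws. 0 \<le> l) \<and> sum_list (map fst ws) = 1 then cc0 cc ws else c)"

text \<open>
  In the following, \<open>u 0\<close> is the fixed point of the range of \<^term>\<open>cc_convexify cc\<close>, and
  \<open>u 1, u 2, \<dots>\<close> enumerates (possibly with repetitions) the fixed countable dense set.
\<close>

definition nearest_index :: "(nat \<Rightarrow> 'a::metric_space) \<Rightarrow> nat \<Rightarrow> 'a \<Rightarrow> nat" where
  "nearest_index u n x = (LEAST i. i \<le> n \<and> dist (u i) x = Min ((\<lambda>j. dist (u j) x) ` {0..n}))"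

definition discretize :: "(nat \<Rightarrow> 'a::metric_space) \<Rightarrow> nat \<Rightarrow> 'a \<Rightarrow> 'a" where
  "discretize u n x = u (nearest_index u n x)"

definition cc_expectation ::
    "((real \<times> 'a::metric_space) list \<Rightarrow> 'a) \<Rightarrow> (nat \<Rightarrow> 'a) \<Rightarrow> 'w measure \<Rightarrow> ('w \<Rightarrow> 'a) \<Rightarrow> 'a" where
  "cc_expectation cc u M X = lim (\<lambda>n. simple_expectation cc M (\<lambda>\<omega>. discretize u n (X \<omega>)))"

text \<open>
  For integrable \<open>X\<close> the limit exists almost surely. Setting the value to \<open>u 0\<close> elsewhere singles out
  a version that is \<open>G\<close>-measurable even if \<open>G\<close> does not contain all null sets.
\<close>

definition cc_cond_expectation ::
    "((real \<times> 'a::metric_space) list \<Rightarrow> 'a) \<Rightarrow> (nat \<Rightarrow> 'a) \<Rightarrow> 'w measure \<Rightarrow> 'w measure \<Rightarrow> ('w \<Rightarrow> 'a) \<Rightarrow> 'w \<Rightarrow> 'a" where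
  "cc_cond_expectation cc u M G X \<omega> =
     (let E = (\<lambda>n. simple_cond_expectation cc (u 0) M G (\<lambda>\<omega>. discretize u n (X \<omega>)) \<omega>)
      in if convergent E then lim E else u 0)"

end

theory Submission
  imports Defs
begin

text \<open>
  On the range \<open>C\<close> of the convexification operator \<open>K\<close> equal points may be merged, so barycentres of
  finitely many points of \<open>C\<close> are associative and behave as in a convex subset of a Banach space; in
  particular they are Lipschitz in the points and in the weights. For simple random elements the
  conditional expectation is a barycentre with the conditional probabilities as weights, which gives
  \<open>d(E(X|G), E(Y|G)) \<le> E(d(X, Y)|G)\<close>. Since \<open>E(d(X, \<psi>\<^sub>n(X))|G)\<close> decreases to 0 almost surely, this inequality
  extends to integrable random elements and reduces each identity to simple ones. For those, the
  tower property and the convex combinations with random coefficients \<open>\<xi>\<close> both follow from the fact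
  that \<open>E(\<cdot>|G)\<close> of a barycentre of fixed points with random weights is taken weight by weight. The
  unconditional case is the tower property for the trivial \<open>\<sigma>\<close>-algebra.
\<close>

section \<open>Convex combinations of multisets\<close>

text \<open>The obstacle is that \<open>[\<lambda>, u; 1 - \<lambda>, u]\<close> need not be
  \<open>u\<close>, and that associativity is postulated only as a merge of two entries. Merging
  equal points has to be earned on the range of \<open>K\<close>: averaging \<open>q\<close> copies
  of \<open>K x\<close> returns \<open>K x\<close>, because \<open>q\<close>-fold averages merely
  select a subsequence of the averages that define \<open>K\<close>. This settles rational weights,
  and continuity settles the others. Associativity with repeated points, and with it the calculus of
  random weights, requires fixed points of \<open>K\<close>. A combination
  \<open>[\<xi>, X; 1 - \<xi>, Y]\<close> of simple random elements is not built from such points,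
  but its image under \<open>K\<close> is, and E(KX|G) = E(X|G) makes the passage free. Continuity
  in the weights is postulated only for two points and inside (0, 1), whereas conditional
  probabilities may vanish. Continuity of general barycentres therefore comes from moving mass to a
  common point, not directly from \<open>cc_continuous\<close>. Random weights are first made
  finitely valued, which turns claims about them into claims about finite partitions.\<close>

definition scale_mset :: "real \<Rightarrow> (real \<times> 'a) multiset \<Rightarrow> (real \<times> 'a) multiset" where
  "scale_mset s = image_mset (\<lambda>(l, u). (s * l, u))"

definition total_weight :: "(real \<times> 'a) multiset \<Rightarrow> real" where
  "total_weight N = (\<Sum>p\<in>#N. fst p)"

definition pos_weights :: "(real \<times> 'a) multiset \<Rightarrow> bool" where
  "pos_weights N \<longleftrightarrow> (\<forall>p\<in>#N. 0 < fst p)"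

lemma scale_mset_simps [simp]:
  "scale_mset s {#} = {#}"
  "scale_mset s (add_mset (l, x) N) = add_mset (s * l, x) (scale_mset s N)"
  "scale_mset s (M + N) = scale_mset s M + scale_mset s N"
  "scale_mset 1 N = N"
  "scale_mset s N = {#} \<longleftrightarrow> N = {#}"
  by (auto simp: scale_mset_def)

lemma scale_mset_scale [simp]: "scale_mset s (scale_mset t N) = scale_mset (s * t) N"
  by (simp add: scale_mset_def multiset.map_comp comp_def case_prod_unfold mult.assoc)

lemma scale_mset_replicate [simp]:
  "scale_mset s (replicate_mset n (l, x)) = replicate_mset n (s * l, x)"
  by (simp add: scale_mset_def)

lemma scale_mset_sum: "scale_mset s (\<Sum>j\<in>J. N j) = (\<Sum>j\<in>J. scale_mset s (N j))"
  by (induction J rule: infinite_finite_induct) auto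

lemma total_weight_simps [simp]:
  "total_weight {#} = 0"
  "total_weight (add_mset p N) = fst p + total_weight N"
  "total_weight (M + N) = total_weight M + total_weight N"
  "total_weight (replicate_mset n p) = n * fst p"
  by (auto simp: total_weight_def)

lemma total_weight_scale [simp]: "total_weight (scale_mset s N) = s * total_weight N"
  by (induction N) (auto simp: algebra_simps)

lemma total_weight_sum: "total_weight (\<Sum>j\<in>J. N j) = (\<Sum>j\<in>J. total_weight (N j))"
  by (induction J rule: infinite_finite_induct) auto

lemma pos_weights_simps [simp]:
  "pos_weights {#}"
  "pos_weights (add_mset p N) \<longleftrightarrow> 0 < fst p \<and> pos_weights N"
  "pos_weights (M + N) \<longleftrightarrow> pos_weights M \<and> pos_weights N"
  by (auto simp: pos_weights_def)

lemma pos_weights_scale [simp]: "0 < s \<Longrightarrow> pos_weights (scale_mset s N) \<longleftrightarrow> pos_weights N"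
  by (induction N) (auto simp: zero_less_mult_iff)

lemma pos_weights_replicate [simp]: "0 < fst p \<Longrightarrow> pos_weights (replicate_mset n p)"
  by (auto simp: pos_weights_def)

lemma pos_weights_sum: "(\<And>j. j \<in> J \<Longrightarrow> pos_weights (N j)) \<Longrightarrow> pos_weights (\<Sum>j\<in>J. N j)"
  by (induction J rule: infinite_finite_induct) auto

lemma total_weight_nonneg: "pos_weights N \<Longrightarrow> 0 \<le> total_weight N"
  by (induction N) auto

lemma total_weight_pos: "pos_weights N \<Longrightarrow> N \<noteq> {#} \<Longrightarrow> 0 < total_weight N"
  by (induction N) (auto simp: total_weight_nonneg add_pos_nonneg)

definition convex_weights :: "(real \<times> 'a) multiset \<Rightarrow> bool" where
  "convex_weights N \<longleftrightarrow> pos_weights N \<and> total_weight N = 1"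

lemma convex_weights_mset: "convex_weights (mset ws) \<longleftrightarrow> cc_weights ws"
  by (auto simp: convex_weights_def cc_weights_def pos_weights_def total_weight_def
      case_prod_unfold simp flip: sum_mset_sum_list)

lemma convex_weights_nonempty: "convex_weights N \<Longrightarrow> N \<noteq> {#}"
  by (auto simp: convex_weights_def)

context cc_space
begin

text \<open>Multisets build permutation invariance into the notation, so any two entries can be
  brought together. By \<open>cc_permute\<close> the chosen list is immaterial when the weights are
  convex; for other multisets nothing is claimed.\<close>

definition mcc :: "(real \<times> 'a) multiset \<Rightarrow> 'a" where
  "mcc N = cc (SOME ws. mset ws = N)"

lemma cc_cong_mset:
  assumes "mset xs = mset ys" "cc_weights ys"
  shows "cc xs = cc ys"
  using assms mset_eq_permutation[OF assms(1)] cc_permute by metis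

lemma mcc_mset: "cc_weights ws \<Longrightarrow> mcc (mset ws) = cc ws"
  unfolding mcc_def by (rule cc_cong_mset[OF someI]) auto

lemma mcc_single [simp]: "mcc {#(1, x)#} = x"
  using mcc_mset[of "[(1, x)]"] by (simp add: cc_single cc_weights_def)

lemma mcc_pair: "0 < l \<Longrightarrow> l < 1 \<Longrightarrow> mcc {#(l, x), (1 - l, y)#} = cc [(l, x), (1 - l, y)]"
  using mcc_mset[of "[(l, x), (1 - l, y)]"] by (simp add: cc_weights_def)

text \<open>\<open>cc_merge\<close> handles the last two entries of a list; in a multiset any two
  entries can be put there.\<close>

lemma mcc_merge:
  assumes "convex_weights (add_mset (a, x) (add_mset (b, y) N))"
  shows "mcc (add_mset (a, x) (add_mset (b, y) N)) =
    mcc (add_mset (a + b, mcc {#(a / (a + b), x), (b / (a + b), y)#}) N)"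
proof -
  obtain ws where ws: "mset ws = N" by (metis ex_mset)
  have 1: "cc_weights (ws @ [(a, x), (b, y)])"
    using assms ws by (simp add: add_mset_commute flip: convex_weights_mset)
  then have ab: "0 < a" "0 < b" by (auto simp: cc_weights_def)
  have 2: "cc_weights (ws @ [(a + b, z)])" for z
    using 1 by (auto simp: cc_weights_def)
  have 3: "cc_weights [(a / (a + b), x), (b / (a + b), y)]"
    using ab by (auto simp: cc_weights_def simp flip: add_divide_distrib)
  have "mcc (mset (ws @ [(a, x), (b, y)])) = mcc (mset (ws @ [(a + b,
      cc [(a / (a + b), x), (b / (a + b), y)])]))"
    using cc_merge[OF 1] mcc_mset[OF 1] mcc_mset[OF 2] by metis
  then show ?thesis using ws mcc_mset[OF 3]
    by (simp add: add_mset_commute)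
qed

text \<open>Induction on the size of \<open>N\<close>: merging two entries of \<open>N\<close>
  shortens it and keeps its total weight, and the same merge is available inside the rescaled
  copy.\<close>

lemma mcc_group:
  assumes "convex_weights (M + N)" "N \<noteq> {#}"
  shows "mcc (M + N) =
    mcc (add_mset (total_weight N, mcc (scale_mset (1 / total_weight N) N)) M)"
  using assms
proof (induction "size N" arbitrary: N rule: less_induct)
  case less
  obtain a x N1 where N1: "N = add_mset (a, x) N1"
    using less.prems(2) by (metis multiset_cases surj_pair)
  show ?case
  proof (cases "N1 = {#}")
    case True
    then show ?thesis using less.prems N1 by (auto simp: convex_weights_def)
  next
    case False
    then obtain b y N2 where N2: "N1 = add_mset (b, y) N2"
      by (metis multiset_cases surj_pair)
    define t where "t = total_weight N"
    have ab: "0 < a" "0 < b" and pos: "pos_weights N"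
      using less.prems N1 N2 by (auto simp: convex_weights_def)
    have t: "0 < t" using pos less.prems(2) by (simp add: t_def total_weight_pos)
    let ?w = "mcc {#(a / (a + b), x), (b / (a + b), y)#}"
    define N' where "N' = add_mset (a + b, ?w) N2"
    have "mcc (M + N) = mcc (M + N')"
      using mcc_merge[of a x b y "M + N2"] less.prems(1) by (simp add: N1 N2 N'_def)
    also have "\<dots> = mcc (add_mset (total_weight N', mcc (scale_mset (1 / total_weight N') N')) M)"
      by (rule less.hyps) (use less.prems in \<open>auto simp: N1 N2 N'_def convex_weights_def\<close>)
    also have "total_weight N' = t" by (simp add: N'_def t_def N1 N2)
    \<comment> \<open>The ratios \<open>a / (a + b)\<close> and \<open>b / (a + b)\<close> do not
      change when all weights are divided by \<open>t\<close>, so the merge inside the normalised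
      block produces the same point \<open>?w\<close>.\<close>
    also have "mcc (scale_mset (1 / t) N') = mcc (scale_mset (1 / t) N)"
    proof -
      have "convex_weights (scale_mset (1 / t) N)"
        using t pos by (simp add: convex_weights_def flip: t_def)
      then show ?thesis
        using mcc_merge[of "a / t" x "b / t" y "scale_mset (1 / t) N2"] t ab
        by (simp add: N1 N2 N'_def flip: add_divide_distrib)
    qed
    finally show ?thesis by (simp add: t_def)
  qed
qed

text \<open>Blocks are collapsed one at a time; the generalisation over \<open>M\<close> lets a
  collapsed block join the part that stays untouched. Empty blocks have no normalised version and
  are skipped.\<close>

lemma mcc_flatten:
  assumes "finite J" "convex_weights (M + (\<Sum>j\<in>J. N j))"
  shows "mcc (M + (\<Sum>j\<in>J. N j)) = mcc (M + (\<Sum>j\<in>J. if N j = {#} then {#}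
     else {#(total_weight (N j), mcc (scale_mset (1 / total_weight (N j)) (N j)))#}))"
  using assms
proof (induction J arbitrary: M rule: finite_induct)
  case (insert j J)
  let ?f = "\<lambda>j. if N j = {#} then {#}
     else {#(total_weight (N j), mcc (scale_mset (1 / total_weight (N j)) (N j)))#}"
  have cw: "convex_weights ((M + N j) + (\<Sum>j\<in>J. N j))"
    using insert by (simp add: ac_simps)
  have 1: "mcc (M + (\<Sum>j\<in>insert j J. N j)) = mcc ((M + N j) + (\<Sum>j\<in>J. N j))"
    using insert by (simp add: ac_simps)
  show ?case
  proof (cases "N j = {#}")
    case True
    then show ?thesis using insert by simp
  next
    case False
    have "mcc ((M + (\<Sum>j\<in>J. N j)) + N j) = mcc ((M + ?f j) + (\<Sum>j\<in>J. N j))"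
      using mcc_group[of "M + (\<Sum>j\<in>J. N j)" "N j"] cw False by (simp add: ac_simps)
    also have "\<dots> = mcc ((M + ?f j) + (\<Sum>j\<in>J. ?f j))"
      by (rule insert.IH)
       (use cw False total_weight_pos[of "N j"] in \<open>auto simp: convex_weights_def ac_simps\<close>)
    finally show ?thesis using 1 insert by (simp add: ac_simps)
  qed
qed auto

text \<open>A multiset of triples keeps the two combinations aligned, so that the same two entries
  are merged in both. \<open>cc_dist\<close> bounds the merged points, and the factor
  \<open>a + b\<close> turns this bound into the contribution of the two original entries.\<close>

lemma mcc_dist:
  fixes T :: "(real \<times> 'a \<times> 'a) multiset"
  assumes "\<And>t. t \<in># T \<Longrightarrow> 0 < fst t" "(\<Sum>t\<in>#T. fst t) = 1"
  shows "dist (mcc {#(l, x). (l, x, y) \<in># T#}) (mcc {#(l, y). (l, x, y) \<in># T#})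
    \<le> (\<Sum>(l, x, y)\<in>#T. l * dist x y)"
  using assms
proof (induction "size T" arbitrary: T rule: less_induct)
  case less
  have "T \<noteq> {#}" using less.prems by auto
  then obtain a x y T1 where T1: "T = add_mset (a, x, y) T1"
    by (metis multiset_cases surj_pair)
  show ?case
  proof (cases "T1 = {#}")
    case True
    then show ?thesis using less.prems T1 by auto
  next
    case False
    then obtain b x' y' T2 where T2: "T1 = add_mset (b, x', y') T2"
      by (metis multiset_cases surj_pair)
    have ab: "0 < a" "0 < b" using less.prems(1)[of "(a, x, y)"] less.prems(1)[of "(b, x', y')"] by (auto simp: T1 T2)
    have pos2: "0 < fst t" if "t \<in># T2" for t
      using less.prems(1)[of t] that by (simp add: T1 T2)
    let ?w = "\<lambda>x x'. mcc {#(a / (a + b), x), (b / (a + b), x')#}"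
    define l where "l = a / (a + b)"
    have l: "0 < l" "l < 1" "b / (a + b) = 1 - l"
      using ab by (auto simp: l_def field_simps)
    define T' where "T' = add_mset (a + b, ?w x x', ?w y y') T2"
    have pos: "pos_weights {#(l, x). (l, x, y) \<in># T2#}" "pos_weights {#(l, y). (l, x, y) \<in># T2#}"
      using pos2 by (force simp: pos_weights_def)+
    have tot: "total_weight {#(l, x). (l, x, y) \<in># T2#} = (\<Sum>t\<in>#T2. fst t)"
       "total_weight {#(l, y). (l, x, y) \<in># T2#} = (\<Sum>t\<in>#T2. fst t)"
      by (simp_all add: total_weight_def multiset.map_comp comp_def case_prod_unfold)
    have e1: "mcc {#(l, x). (l, x, y) \<in># T#} = mcc {#(l, x). (l, x, y) \<in># T'#}"
      unfolding T1 T2 T'_def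
      using mcc_merge[of a x b x' "{#(l, x). (l, x, y) \<in># T2#}"] less.prems pos tot
      by (simp add: T1 T2 convex_weights_def ab)
    have e2: "mcc {#(l, y). (l, x, y) \<in># T#} = mcc {#(l, y). (l, x, y) \<in># T'#}"
      unfolding T1 T2 T'_def
      using mcc_merge[of a y b y' "{#(l, y). (l, x, y) \<in># T2#}"] less.prems pos tot
      by (simp add: T1 T2 convex_weights_def ab)
    have IH: "dist (mcc {#(l, x). (l, x, y) \<in># T'#}) (mcc {#(l, y). (l, x, y) \<in># T'#})
       \<le> (\<Sum>(l, x, y)\<in>#T'. l * dist x y)"
      by (rule less.hyps) (use less.prems(2) ab in \<open>auto simp: T1 T2 T'_def dest: pos2\<close>)
    have "dist (?w x x') (?w y y') \<le> l * dist x y + (1 - l) * dist x' y'"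
      using cc_dist[of l x x' y y'] mcc_pair[of l] l by (simp add: l_def)
    then have "(a + b) * dist (?w x x') (?w y y') \<le> (a + b) * (l * dist x y + (1 - l) * dist x' y')"
      using ab by (intro mult_left_mono) auto
    also have "\<dots> = a * dist x y + b * dist x' y'"
    proof -
      have "(a + b) * l = a" "(a + b) * (1 - l) = b"
        using ab l(3) by (simp_all add: l_def field_simps)
      then show ?thesis by (metis distrib_left mult.assoc)
    qed
    finally have "(\<Sum>(l, x, y)\<in>#T'. l * dist x y) \<le> (\<Sum>(l, x, y)\<in>#T. l * dist x y)"
      by (simp add: T'_def T1 T2)
    then show ?thesis using IH e1 e2 by simp
  qed
qed

section \<open>Iterated averages, the convexification operator and the merging of equal
  points\<close>

abbreviation K where "K \<equiv> cc_convexify cc"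

definition avg :: "nat \<Rightarrow> 'a \<Rightarrow> 'a" where
  "avg n x = mcc (replicate_mset n (1 / real n, x))"

lemma mcc_dist_sum:
  assumes "finite J" "\<And>j. j \<in> J \<Longrightarrow> 0 \<le> w j" "(\<Sum>j\<in>J. w j) = 1"
  shows "dist (mcc (\<Sum>j\<in>J. if 0 < w j then {#(w j, x j)#} else {#}))
              (mcc (\<Sum>j\<in>J. if 0 < w j then {#(w j, y j)#} else {#}))
    \<le> (\<Sum>j\<in>J. w j * dist (x j) (y j))"
proof -
  let ?T = "\<Sum>j\<in>J. if 0 < w j then {#(w j, x j, y j)#} else {#}"
  have T: "{#(l, x). (l, x, y) \<in># ?T#} = (\<Sum>j\<in>J. if 0 < w j then {#(w j, x j)#} else {#})"
     "{#(l, y). (l, x, y) \<in># ?T#} = (\<Sum>j\<in>J. if 0 < w j then {#(w j, y j)#} else {#})"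
    using assms(1) by induction auto
  have pos: "0 < fst t" if "t \<in># ?T" for t
    using assms(1) that by induction (auto split: if_splits)
  have tot: "(\<Sum>t\<in>#?T. fst t) = (\<Sum>j\<in>J. w j)"
    using assms(1,2) by induction (auto simp: less_le)
  have rhs: "(\<Sum>(l, x, y)\<in>#?T. l * dist x y) = (\<Sum>j\<in>J. w j * dist (x j) (y j))"
    using assms(1,2) by induction (auto simp: less_le)
  show ?thesis
    using mcc_dist[of ?T] pos tot assms(3) unfolding T rhs by simp
qed

lemma avg_LIMSEQ: "(\<lambda>n. avg (Suc n) x) \<longlonglongrightarrow> K x"
proof -
  have "avg (Suc n) x = cc (replicate (Suc n) (1 / real (Suc n), x))" for n
    unfolding avg_def
    by (subst mset_replicate[symmetric], rule mcc_mset)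
      (auto simp: cc_weights_def sum_list_replicate simp del: replicate_Suc of_nat_Suc)
  then show ?thesis
    using cc_convexifiable[of x] by (simp add: cc_convexify_def convergent_LIMSEQ_iff)
qed

lemma avg_LIMSEQ':
  assumes "strict_mono r" shows "(\<lambda>n. avg (Suc (r n)) x) \<longlonglongrightarrow> K x"
  using LIMSEQ_subseq_LIMSEQ[OF avg_LIMSEQ assms] by (simp add: comp_def)

lemma replicate_mset_eq_sum: "replicate_mset n p = (\<Sum>i<n. {#p#})"
  by (induction n) auto

lemma dist_avg_le:
  assumes "0 < n" shows "dist (avg n x) (avg n y) \<le> dist x y"
  using mcc_dist_sum[of "{..<n}" "\<lambda>_. 1 / real n" "\<lambda>_. x" "\<lambda>_. y"] assms
  by (simp add: avg_def replicate_mset_eq_sum)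

lemma dist_K_le: "dist (K x) (K y) \<le> dist x y"
  by (rule LIMSEQ_le_const2[OF tendsto_dist[OF avg_LIMSEQ avg_LIMSEQ]]) (auto intro!: dist_avg_le)

lemma mcc_flatten0:
  assumes "finite J" "convex_weights (\<Sum>j\<in>J. N j)" "\<And>j. j \<in> J \<Longrightarrow> N j \<noteq> {#}"
  shows "mcc (\<Sum>j\<in>J. N j) =
    mcc (\<Sum>j\<in>J. {#(total_weight (N j), mcc (scale_mset (1 / total_weight (N j)) (N j)))#})"
proof -
  have "(\<Sum>j\<in>J. if N j = {#} then {#}
     else {#(total_weight (N j), mcc (scale_mset (1 / total_weight (N j)) (N j)))#}) =
     (\<Sum>j\<in>J. {#(total_weight (N j), mcc (scale_mset (1 / total_weight (N j)) (N j)))#})"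
    using assms(3) by (intro sum.cong) auto
  then show ?thesis
    using mcc_flatten[of J "{#}" N] assms by simp
qed

text \<open>Both sides come from one multiset, with \<open>n\<close> entries of weight
  \<open>w j / n\<close> at \<open>x j\<close> for each \<open>j\<close>, grouped either by copy or
  by index.\<close>

lemma avg_mcc:
  assumes J: "finite J" "\<And>j. j \<in> J \<Longrightarrow> 0 < w j" "(\<Sum>j\<in>J. w j) = 1" and n: "0 < n"
  shows "avg n (mcc (\<Sum>j\<in>J. {#(w j, x j)#})) = mcc (\<Sum>j\<in>J. {#(w j, avg n (x j))#})"
proof -
  let ?N = "\<Sum>j\<in>J. {#(w j, x j)#}"
  have cw: "convex_weights ?N"
    using J by (simp add: convex_weights_def pos_weights_sum total_weight_sum)
  have [simp]: "?N \<noteq> {#}" "total_weight ?N = 1" "pos_weights ?N"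
    using cw convex_weights_nonempty by (auto simp: convex_weights_def)
  have "avg n (mcc ?N) = mcc (\<Sum>i<n. scale_mset (1 / n) ?N)"
    using n unfolding avg_def replicate_mset_eq_sum
    by (subst mcc_flatten0[of _ "\<lambda>_. scale_mset (1 / n) ?N"])
      (auto simp: convex_weights_def total_weight_sum pos_weights_sum J(3))
  also have "(\<Sum>i<n. scale_mset (1 / n) ?N) = (\<Sum>j\<in>J. replicate_mset n (w j / n, x j))"
    by (simp add: scale_mset_sum replicate_mset_eq_sum sum.swap[of _ J])
  also have "mcc \<dots> = mcc (\<Sum>j\<in>J. {#(w j, avg n (x j))#})"
    unfolding avg_def
    using n J by (subst mcc_flatten0)
       (auto simp: convex_weights_def total_weight_sum pos_weights_sum less_imp_neq[symmetric] intro!: arg_cong[of _ _ mcc] sum.cong)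
  finally show ?thesis .
qed

text \<open>Limit of \<open>avg_mcc\<close>: for fixed positive weights \<open>mcc\<close> is
  continuous in the points by \<open>mcc_dist_sum\<close>.\<close>

lemma K_mcc:
  assumes J: "finite J" "\<And>j. j \<in> J \<Longrightarrow> 0 < w j" "(\<Sum>j\<in>J. w j) = 1"
  shows "K (mcc (\<Sum>j\<in>J. {#(w j, x j)#})) = mcc (\<Sum>j\<in>J. {#(w j, K (x j))#})"
proof -
  have sumeq: "(\<Sum>j\<in>J. {#(w j, y j)#}) = (\<Sum>j\<in>J. if 0 < w j then {#(w j, y j)#} else {#})" for y :: "_ \<Rightarrow> 'a"
    using J(2) by (intro sum.cong) auto
  have "(\<lambda>n. mcc (\<Sum>j\<in>J. {#(w j, avg (Suc n) (x j))#})) \<longlonglongrightarrow> mcc (\<Sum>j\<in>J. {#(w j, K (x j))#})"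
  proof (rule metric_tendsto_imp_tendsto)
    show "(\<lambda>n. \<Sum>j\<in>J. w j * dist (avg (Suc n) (x j)) (K (x j))) \<longlonglongrightarrow> 0"
      by (intro tendsto_null_sum tendsto_mult_right_zero) (rule avg_LIMSEQ[THEN tendsto_dist_iff[THEN iffD1]])
    show "\<forall>\<^sub>F n in sequentially. dist (mcc (\<Sum>j\<in>J. {#(w j, avg (Suc n) (x j))#})) (mcc (\<Sum>j\<in>J. {#(w j, K (x j))#}))
        \<le> dist (\<Sum>j\<in>J. w j * dist (avg (Suc n) (x j)) (K (x j))) 0"
      unfolding sumeq using mcc_dist_sum[of J w] J by (force simp: less_imp_le intro!: always_eventually order_trans[OF _ abs_ge_self])
  qed
  moreover have "(\<lambda>n. mcc (\<Sum>j\<in>J. {#(w j, avg (Suc n) (x j))#})) = (\<lambda>n. avg (Suc n) (mcc (\<Sum>j\<in>J. {#(w j, x j)#})))"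
    using avg_mcc[OF J] by simp
  ultimately show ?thesis
    using LIMSEQ_unique[OF avg_LIMSEQ] by simp
qed

lemma avg_avg:
  assumes "0 < m" "0 < n"
  shows "avg m (avg n x) = avg (m * n) x"
proof -
  have "avg (m * n) x = mcc (\<Sum>i<m. replicate_mset n (1 / (m * n), x))"
    unfolding avg_def by (intro arg_cong[of _ _ mcc] multiset_eqI) (simp add: count_sum)
  also have "\<dots> = avg m (avg n x)"
    using assms unfolding avg_def replicate_mset_eq_sum[of m]
    by (subst mcc_flatten0) (auto simp: convex_weights_def total_weight_sum pos_weights_sum)
  finally show ?thesis by simp
qed

text \<open>\<open>avg q\<close> is nonexpansive, hence compatible with limits; applied to the
  averages of \<open>x\<close> it gives averages of \<open>q * Suc n\<close> copies, a subsequence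
  of those that define \<open>K x\<close>.\<close>

lemma avg_K: "0 < q \<Longrightarrow> avg q (K x) = K x"
proof -
  assume q: "0 < q"
  have "(\<lambda>n. avg q (avg (Suc n) x)) \<longlonglongrightarrow> avg q (K x)"
    by (rule metric_tendsto_imp_tendsto[OF avg_LIMSEQ[of x]]) (auto intro!: always_eventually dist_avg_le q)
  \<comment> \<open>The index is \<open>q * Suc n - 1\<close> because \<open>avg_LIMSEQ'\<close>
    counts copies by \<open>Suc\<close>.\<close>
  moreover have "(\<lambda>n. avg (Suc (q * Suc n - 1)) x) \<longlonglongrightarrow> K x"
    by (rule avg_LIMSEQ') (use q in \<open>auto simp: strict_mono_def intro!: diff_less_mono\<close>)
  ultimately show ?thesis
    using q by (simp add: avg_avg LIMSEQ_unique)
qed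

lemma K_K [simp]: "K (K x) = K x"
  using avg_K avg_LIMSEQ[of "K x"] LIMSEQ_unique[OF _ tendsto_const] by fastforce

text \<open>Split \<open>q\<close> copies of \<open>K x\<close> into groups of \<open>p\<close> and
  \<open>q - p\<close>; by \<open>avg_K\<close> the whole and both groups average to
  \<open>K x\<close>.\<close>

lemma cc_pair_K_rational:
  assumes "0 < p" "p < q"
  shows "cc [(real p / q, K x), (1 - real p / q, K x)] = K x"
proof -
  have "K x = avg q (K x)"
    using avg_K[of q x] assms by simp
  also have "\<dots> = mcc (replicate_mset p (1 / q, K x) + replicate_mset (q - p) (1 / q, K x))"
    unfolding avg_def using assms by (intro arg_cong[of _ _ mcc] multiset_eqI) simp
  also have "\<dots> = mcc (\<Sum>b\<in>{True, False}. if b then replicate_mset p (1 / q, K x) else replicate_mset (q - p) (1 / q, K x))"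
    by simp
  also have "\<dots> = mcc {#(p / q, avg p (K x)), ((real q - real p) / q, avg (q - p) (K x))#}"
    using assms by (subst mcc_flatten0)
      (auto simp: convex_weights_def of_nat_diff avg_def add_mset_commute simp flip: diff_divide_distrib add_divide_distrib)
  also have "\<dots> = cc [(real p / q, K x), (1 - real p / q, K x)]"
    using assms avg_K mcc_pair[of "p / q"] by (simp add: diff_divide_distrib)
  finally show ?thesis by simp
qed

lemma cc_pair_K:
  assumes l: "0 < l" "l < 1"
  shows "cc [(l, K x), (1 - l, K x)] = K x"
proof -
  have ex: "\<exists>p q. 0 < p \<and> p < q \<and> \<bar>real p / real q - l\<bar> < 1 / Suc n" for n
  proof -
    \<comment> \<open>The bound \<open>max 0\<close> forces \<open>p > 0\<close>, and
      \<open>r < l < 1\<close> forces \<open>p < q\<close>: \<open>cc_continuous\<close> asks for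
      approximating weights strictly inside (0, 1).\<close>
    obtain r where r: "r \<in> \<rat>" "max 0 (l - 1 / Suc n) < r" "r < l"
      using Rats_dense_in_real[of "max 0 (l - 1 / Suc n)" l] l by auto
    then obtain p q where pq: "q \<noteq> 0" "\<bar>r\<bar> = real p / real q"
      using Rats_abs_nat_div_natE[OF r(1)] by metis
    have "0 < r" using r(2) by simp
    then have "real p = r * real q" using pq by simp
    moreover have "r * real q < 1 * real q"
      using pq(1) r(3) l by (intro mult_strict_right_mono) auto
    moreover have "0 < r * real q" using pq(1) \<open>0 < r\<close> by simp
    ultimately have "p < q" "0 < p" by simp_all
    then show ?thesis using pq r by (intro exI[of _ p] exI[of _ q]) auto
  qed
  then obtain p q where pq: "\<And>n. 0 < p n" "\<And>n. p n < q n" "\<And>n. \<bar>real (p n) / real (q n) - l\<bar> < 1 / Suc n"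
    by metis
  have lim: "(\<lambda>n. real (p n) / real (q n)) \<longlonglongrightarrow> l"
  proof (rule metric_tendsto_imp_tendsto)
    show "(\<lambda>n. 1 / real (Suc n)) \<longlonglongrightarrow> 0"
      by (rule LIMSEQ_inverse_real_of_nat[unfolded inverse_eq_divide])
  qed (use pq(3) in \<open>auto simp: dist_real_def less_imp_le\<close>)
  have "(\<lambda>n. cc [(real (p n) / real (q n), K x), (1 - real (p n) / real (q n), K x)]) \<longlonglongrightarrow> cc [(l, K x), (1 - l, K x)]"
    by (rule cc_continuous) (use l lim pq(1,2) in \<open>auto simp: divide_less_eq order.strict_trans[OF pq(1) pq(2)]\<close>)
  then show ?thesis
    using pq(1,2) by (simp add: cc_pair_K_rational LIMSEQ_const_iff)
qed

text \<open>Entries are merged two at a time, and by \<open>cc_pair_K\<close> each merge returns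
  \<open>x\<close>.\<close>

lemma mcc_const:
  assumes "K x = x" "convex_weights N" "\<And>p. p \<in># N \<Longrightarrow> snd p = x"
  shows "mcc N = x"
  using assms(2,3)
proof (induction "size N" arbitrary: N rule: less_induct)
  case less
  obtain a N1 where N1: "N = add_mset (a, x) N1"
    using convex_weights_nonempty less.prems by (metis multiset_cases prod.collapse union_single_eq_member)
  show ?case
  proof (cases "N1 = {#}")
    case True
    then show ?thesis using less.prems N1 by (auto simp: convex_weights_def)
  next
    case False
    then obtain b N2 where N2: "N1 = add_mset (b, x) N2"
      using less.prems(2) N1 by (metis multiset_cases prod.collapse union_single_eq_member insert_iff set_mset_add_mset_insert)
    have ab: "0 < a" "0 < b" using less.prems(1) by (auto simp: N1 N2 convex_weights_def)
    define l where "l = a / (a + b)"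
    have l: "0 < l" "l < 1" "b / (a + b) = 1 - l"
      using ab by (auto simp: l_def field_simps)
    have "mcc {#(a / (a + b), x), (b / (a + b), x)#} = x"
      using cc_pair_K[OF l(1,2), of x] mcc_pair[OF l(1,2)] l(3) assms(1) by (simp add: l_def)
    then have "mcc N = mcc (add_mset (a + b, x) N2)"
      using mcc_merge[of a x b x N2] less.prems by (simp add: N1 N2)
    also have "\<dots> = x"
      by (rule less.hyps) (use less.prems in \<open>auto simp: N1 N2 convex_weights_def\<close>)
    finally show ?thesis .
  qed
qed

end

section \<open>Barycentres in the range of the convexification operator\<close>

definition weights_on :: "'i set \<Rightarrow> ('i \<Rightarrow> real) \<Rightarrow> bool" where
  "weights_on I w \<longleftrightarrow> finite I \<and> (\<forall>i\<in>I. 0 \<le> w i) \<and> (\<Sum>i\<in>I. w i) = 1"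

lemma weights_onD:
  assumes "weights_on I w"
  shows "finite I" "\<And>i. i \<in> I \<Longrightarrow> 0 \<le> w i" "(\<Sum>i\<in>I. w i) = 1"
  using assms by (auto simp: weights_on_def)

lemma weights_on_le_1: "weights_on I w \<Longrightarrow> i \<in> I \<Longrightarrow> w i \<le> 1"
  unfolding weights_on_def by (metis member_le_sum DiffE)

lemma weights_on_delta: "finite I \<Longrightarrow> i \<in> I \<Longrightarrow> weights_on I (\<lambda>j. if j = i then 1 else 0)"
  by (auto simp: weights_on_def)

lemma weights_on_mix:
  assumes "weights_on J p" "\<And>j. j \<in> J \<Longrightarrow> weights_on I (w j)"
  shows "weights_on I (\<lambda>i. \<Sum>j\<in>J. p j * w j i)"
proof -
  have "J \<noteq> {}" using assms(1) by (auto simp: weights_on_def)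
  then have "finite I" using assms(2) by (auto simp: weights_on_def)
  moreover have "(\<Sum>i\<in>I. \<Sum>j\<in>J. p j * w j i) = (\<Sum>j\<in>J. p j * (\<Sum>i\<in>I. w j i))"
    by (simp add: sum.swap[of _ I] sum_distrib_left)
  ultimately show ?thesis
    using assms by (auto simp: weights_on_def intro!: sum_nonneg)
qed

lemma pred_weights_on:
  assumes [measurable]: "\<And>i. i \<in> I \<Longrightarrow> W i \<in> borel_measurable N"
  shows "Measurable.pred N (\<lambda>\<omega>. weights_on I (\<lambda>i. W i \<omega>))"
proof (cases "finite I")
  case True
  have [measurable]: "(\<lambda>\<omega>. \<Sum>i\<in>I. W i \<omega>) \<in> borel_measurable N"
    by (intro borel_measurable_sum) measurable
  show ?thesis
    unfolding weights_on_def using True by (intro pred_intros_logic pred_intros_finite) measurable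
qed (simp add: weights_on_def)

context cc_space
begin

definition bary :: "'i set \<Rightarrow> ('i \<Rightarrow> real) \<Rightarrow> ('i \<Rightarrow> 'a) \<Rightarrow> 'a" where
  "bary I w x = mcc (\<Sum>i\<in>I. if 0 < w i then {#(w i, x i)#} else {#})"

lemma convex_weights_bary:
  assumes "weights_on I w"
  shows "convex_weights (\<Sum>i\<in>I. if 0 < w i then {#(w i, x i)#} else {#})"
proof -
  have "total_weight (\<Sum>i\<in>I. if 0 < w i then {#(w i, x i)#} else {#}) = (\<Sum>i\<in>I. w i)"
    unfolding total_weight_sum using weights_onD(2)[OF assms]
    by (intro sum.cong) (auto simp: less_le)
  then show ?thesis
    using assms by (auto simp: convex_weights_def weights_on_def intro!: pos_weights_sum)
qed

lemma bary_cong: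
  assumes "\<And>i. i \<in> I \<Longrightarrow> w i = v i" "\<And>i. i \<in> I \<Longrightarrow> 0 < v i \<Longrightarrow> x i = y i"
  shows "bary I w x = bary I v y"
  unfolding bary_def using assms by (intro arg_cong[of _ _ mcc] sum.cong) auto

lemma bary_mono_neutral:
  assumes "finite J" "I \<subseteq> J" "\<And>j. j \<in> J - I \<Longrightarrow> w j = 0"
  shows "bary I w x = bary J w x"
  unfolding bary_def using assms by (intro arg_cong[of _ _ mcc] sum.mono_neutral_left) auto

lemma dist_bary_le:
  assumes "weights_on I w"
  shows "dist (bary I w x) (bary I w y) \<le> (\<Sum>i\<in>I. w i * dist (x i) (y i))"
  unfolding bary_def using assms by (intro mcc_dist_sum) (auto simp: weights_on_def)

lemma bary_delta:
  assumes "finite I" "i \<in> I"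
  shows "bary I (\<lambda>j. if j = i then 1 else 0) x = x i"
proof -
  have "(\<Sum>j\<in>I. if 0 < (if j = i then 1 else 0 :: real) then {#((if j = i then 1 else 0 :: real), x j)#} else {#})
    = (\<Sum>j\<in>I. if j = i then {#(1, x j)#} else {#})"
    by (intro sum.cong) auto
  also have "\<dots> = {#(1, x i)#}" using assms by simp
  finally show ?thesis by (simp only: bary_def mcc_single)
qed

lemma bary_const:
  assumes "weights_on I w" "K c = c"
  shows "bary I w (\<lambda>_. c) = c"
  unfolding bary_def
proof (rule mcc_const[OF assms(2) convex_weights_bary[OF assms(1)]])
  show "snd p = c" if "p \<in># (\<Sum>i\<in>I. if 0 < w i then {#(w i, c)#} else {#})" for p
    using weights_onD(1)[OF assms(1)] that by induction (auto split: if_splits)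
qed

lemma K_bary:
  assumes "weights_on I w"
  shows "K (bary I w x) = bary I w (\<lambda>i. K (x i))"
proof -
  have eq: "(\<Sum>i\<in>I. if 0 < w i then {#(w i, y i)#} else {#}) = (\<Sum>i\<in>{i\<in>I. 0 < w i}. {#(w i, y i)#})"
    for y :: "_ \<Rightarrow> 'a"
    using weights_onD(1)[OF assms] by (simp add: sum.inter_filter)
  have "(\<Sum>i\<in>{i\<in>I. 0 < w i}. w i) = (\<Sum>i\<in>I. w i)"
    using assms by (intro sum.mono_neutral_left) (auto simp: weights_on_def less_le)
  then show ?thesis
    unfolding bary_def eq using assms by (intro K_mcc) (auto simp: weights_on_def)
qed

text \<open>The multiset of all entries \<open>(p j * w j i, x i)\<close> is collapsed in two ways.
  Grouped by \<open>j\<close> it gives the iterated barycentre; grouped by \<open>i\<close> it puts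
  together copies of the single point \<open>x i\<close>, and this is where
  \<open>K (x i) = x i\<close> enters, through \<open>mcc_const\<close>.\<close>

lemma bary_bary:
  assumes p: "weights_on J p" and w: "\<And>j. j \<in> J \<Longrightarrow> weights_on I (w j)"
    and x: "\<And>i. i \<in> I \<Longrightarrow> K (x i) = x i"
  shows "bary J p (\<lambda>j. bary I (w j) x) = bary I (\<lambda>i. \<Sum>j\<in>J. p j * w j i) x"
proof -
  \<comment> \<open>\<open>S j\<close> and \<open>L i\<close> are the blocks of the two groupings,
    with total weights \<open>p j\<close> and \<open>v i\<close>; \<open>B j\<close> is the inner
    combination before scaling. Entries of weight 0 are absent from all of them.\<close>
  define B where "B j = (\<Sum>i\<in>I. if 0 < w j i then {#(w j i, x i)#} else {#})" for j
  define S where "S j = (if 0 < p j then scale_mset (p j) (B j) else {#})" for j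
  define L where "L i = (\<Sum>j\<in>J. if 0 < p j \<and> 0 < w j i then {#(p j * w j i, x i)#} else {#})" for i
  define v where "v i = (\<Sum>j\<in>J. p j * w j i)" for i
  have B: "convex_weights (B j)" if "j \<in> J" for j
    unfolding B_def by (rule convex_weights_bary[OF w[OF that]])
  have p0: "0 \<le> p j" if "j \<in> J" for j using weights_onD(2)[OF p that] .
  have w0: "0 \<le> w j i" if "j \<in> J" "i \<in> I" for j i using weights_onD(2)[OF w] that .
  have v: "weights_on I v" unfolding v_def by (rule weights_on_mix[OF p w])
  have S_total: "total_weight (S j) = p j" if "j \<in> J" for j
    using B[OF that] p0[OF that] by (auto simp: S_def convex_weights_def)
  have S_pos: "pos_weights (S j)" if "j \<in> J" for j
    using B[OF that] by (auto simp: S_def convex_weights_def)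
  have cw: "convex_weights (\<Sum>j\<in>J. S j)"
    using S_total S_pos weights_onD(3)[OF p] by (simp add: convex_weights_def total_weight_sum pos_weights_sum)
  have swap: "(\<Sum>j\<in>J. S j) = (\<Sum>i\<in>I. L i)"
  proof -
    have "S j = (\<Sum>i\<in>I. if 0 < p j \<and> 0 < w j i then {#(p j * w j i, x i)#} else {#})" for j
      unfolding S_def B_def scale_mset_sum by (auto intro!: sum.cong)
    then show ?thesis unfolding L_def by (simp add: sum.swap[of _ J])
  qed
  have L_total: "total_weight (L i) = v i" if "i \<in> I" for i
    unfolding L_def v_def total_weight_sum
  proof (rule sum.cong)
    fix j assume "j \<in> J"
    then show "total_weight (if 0 < p j \<and> 0 < w j i then {#(p j * w j i, x i)#} else {#}) = p j * w j i"
      using p0[of j] w0[of j i] that by (auto simp: less_le)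
  qed simp
  have L_pos: "pos_weights (L i)" for i
    unfolding L_def by (auto intro!: pos_weights_sum)
  have L_snd: "snd q = x i" if "q \<in># L i" for i q
    using weights_onD(1)[OF p] that unfolding L_def by induction (auto split: if_splits)
  have L_empty: "L i = {#} \<longleftrightarrow> \<not> 0 < v i" if "i \<in> I" for i
    using L_total[OF that] L_pos[of i] total_weight_pos[of "L i"] by auto
  have "bary J p (\<lambda>j. bary I (w j) x) = mcc (\<Sum>j\<in>J. if S j = {#} then {#}
     else {#(total_weight (S j), mcc (scale_mset (1 / total_weight (S j)) (S j)))#})"
    unfolding bary_def
  proof (intro arg_cong[of _ _ mcc] sum.cong)
    fix j assume j: "j \<in> J"
    show "(if 0 < p j then {#(p j, mcc (\<Sum>i\<in>I. if 0 < w j i then {#(w j i, x i)#} else {#}))#} else {#}) =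
       (if S j = {#} then {#} else {#(total_weight (S j), mcc (scale_mset (1 / total_weight (S j)) (S j)))#})"
      using S_total[OF j] convex_weights_nonempty[OF B[OF j]]
      by (auto simp: S_def B_def[symmetric])
  qed simp
  also have "\<dots> = mcc (\<Sum>j\<in>J. S j)"
    using mcc_flatten[of J "{#}" S] weights_onD(1)[OF p] cw by simp
  also have "\<dots> = mcc (\<Sum>i\<in>I. if L i = {#} then {#}
     else {#(total_weight (L i), mcc (scale_mset (1 / total_weight (L i)) (L i)))#})"
    using mcc_flatten[of I "{#}" L] weights_onD(1)[OF v] cw by (simp add: swap)
  also have "\<dots> = bary I v x"
    unfolding bary_def
  proof (intro arg_cong[of _ _ mcc] sum.cong)
    fix i assume i: "i \<in> I"
    have "mcc (scale_mset (1 / v i) (L i)) = x i" if "0 < v i"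
    proof (rule mcc_const)
      show "convex_weights (scale_mset (1 / v i) (L i))"
        using that L_total[OF i] L_pos by (simp add: convex_weights_def)
      show "snd q = x i" if "q \<in># scale_mset (1 / v i) (L i)" for q
        using that L_snd by (force simp: scale_mset_def)
    qed (rule x[OF i])
    then show "(if L i = {#} then {#} else {#(total_weight (L i), mcc (scale_mset (1 / total_weight (L i)) (L i)))#})
      = (if 0 < v i then {#(v i, x i)#} else {#})"
      using L_empty[OF i] L_total[OF i] by simp
  qed simp
  finally show ?thesis unfolding v_def .
qed

text \<open>\<open>y (f i)\<close> is the barycentre with all mass at \<open>f i\<close>, so
  associativity adds up the weights of the indices with the same image.\<close>

lemma bary_reindex:
  assumes "weights_on I w" "finite J" "f ` I \<subseteq> J" "\<And>j. j \<in> J \<Longrightarrow> K (y j) = y j"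
  shows "bary I w (\<lambda>i. y (f i)) = bary J (\<lambda>j. \<Sum>i\<in>I. if f i = j then w i else 0) y"
proof -
  have "bary I w (\<lambda>i. y (f i)) = bary I w (\<lambda>i. bary J (\<lambda>j. if j = f i then 1 else 0) y)"
    using assms by (intro bary_cong) (auto simp: bary_delta)
  also have "\<dots> = bary J (\<lambda>j. \<Sum>i\<in>I. w i * (if j = f i then 1 else 0)) y"
    using assms by (intro bary_bary weights_on_delta) auto
  also have "\<dots> = bary J (\<lambda>j. \<Sum>i\<in>I. if f i = j then w i else 0) y"
    by (intro bary_cong sum.cong) auto
  finally show ?thesis .
qed

text \<open>Both barycentres are compared with the one in which the excess of the weights over their
  minimum is moved to \<open>c\<close>.\<close>

lemma dist_bary_weights_le:
  assumes w: "weights_on I w" and v: "weights_on I v"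
    and x: "\<And>i. i \<in> I \<Longrightarrow> K (x i) = x i" and c: "K c = c"
  shows "dist (bary I w x) (bary I v x) \<le> (\<Sum>i\<in>I. \<bar>w i - v i\<bar> * dist (x i) c)"
proof -
  define m where "m i = min (w i) (v i)" for i
  define Z where "Z = bary (insert None (Some ` I))
    (\<lambda>j. case j of None \<Rightarrow> 1 - (\<Sum>i\<in>I. m i) | Some i \<Rightarrow> m i)
    (\<lambda>j. case j of None \<Rightarrow> c | Some i \<Rightarrow> x i)"
  have fin: "finite I" using weights_onD(1)[OF w] .
  have key: "dist (bary I u x) Z \<le> (\<Sum>i\<in>I. (u i - m i) * dist (x i) c)"
    if u: "weights_on I u" and mu: "\<And>i. i \<in> I \<Longrightarrow> 0 \<le> m i \<and> m i \<le> u i" for u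
  proof -
    \<comment> \<open>Every index is doubled: \<open>(i, True)\<close> carries the common part
      \<open>m i\<close>, \<open>(i, False)\<close> the excess \<open>u i - m i\<close>. Two
      assignments of points to the same weights \<open>W\<close> give \<open>bary I u x\<close> and
      \<open>Z\<close>, so the estimate for fixed weights applies, and only the excess
      moves.\<close>
    define W where "W = (\<lambda>(i, b). if b then m i else u i - m i)"
    let ?J = "I \<times> (UNIV :: bool set)"
    have sumW: "(\<Sum>q\<in>?J. g q) = (\<Sum>i\<in>I. g (i, True) + g (i, False))" for g :: "_ \<Rightarrow> real"
      by (simp add: sum.cartesian_product[symmetric, where g="\<lambda>i b. g (i, b)", simplified] UNIV_bool add.commute)
    have W: "weights_on ?J W"
      using fin mu weights_onD(3)[OF u] by (auto simp: weights_on_def sumW) (auto simp: W_def)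
    have "bary ?J W (\<lambda>q. x (fst q)) = bary I (\<lambda>i. \<Sum>q\<in>?J. if fst q = i then W q else 0) x"
      by (rule bary_reindex[OF W fin _ x]) auto
    also have "\<dots> = bary I u x"
      using fin by (intro bary_cong) (simp_all add: sumW W_def sum.distrib)
    finally have 1: "bary ?J W (\<lambda>q. x (fst q)) = bary I u x" .
    let ?f = "\<lambda>(i, b). if b then Some i else None"
    let ?y = "\<lambda>j. case j of None \<Rightarrow> c | Some i \<Rightarrow> x i"
    have "bary ?J W (\<lambda>q. ?y (?f q)) = bary (insert None (Some ` I)) (\<lambda>j. \<Sum>q\<in>?J. if ?f q = j then W q else 0) ?y"
      by (rule bary_reindex[OF W]) (use fin x c in auto)
    also have "\<dots> = Z"
      unfolding Z_def using fin weights_onD(3)[OF u]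
      by (intro bary_cong) (auto simp: sumW W_def sum_subtractf split: option.split)
    finally have "dist (bary I u x) Z \<le> (\<Sum>q\<in>?J. W q * dist (x (fst q)) (?y (?f q)))"
      using dist_bary_le[OF W, of "\<lambda>q. x (fst q)" "\<lambda>q. ?y (?f q)"] 1 by simp
    also have "\<dots> = (\<Sum>i\<in>I. (u i - m i) * dist (x i) c)"
      by (simp add: sumW W_def)
    finally show ?thesis .
  qed
  have "dist (bary I w x) (bary I v x) \<le> dist (bary I w x) Z + dist (bary I v x) Z"
    by (rule dist_triangle2)
  also have "\<dots> \<le> (\<Sum>i\<in>I. (w i - m i) * dist (x i) c) + (\<Sum>i\<in>I. (v i - m i) * dist (x i) c)"
    using weights_onD(2)[OF w] weights_onD(2)[OF v] by (intro add_mono key w v) (auto simp: m_def)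
  also have "\<dots> = (\<Sum>i\<in>I. \<bar>w i - v i\<bar> * dist (x i) c)"
    unfolding sum.distrib[symmetric] by (intro sum.cong) (auto simp: m_def min_def algebra_simps)
  finally show ?thesis .
qed

lemma cc0_eq_bary:
  assumes "distinct xs" "weights_on (set xs) w"
  shows "cc0 cc (map (\<lambda>x. (w x, y x)) xs) = bary (set xs) w y"
proof -
  let ?f = "filter (\<lambda>(l, u). l \<noteq> 0) (map (\<lambda>x. (w x, y x)) xs)"
  have "mset ?f = (\<Sum>x\<in>set xs. if 0 < w x then {#(w x, y x)#} else {#})"
    using assms(1) weights_onD(2)[OF assms(2)] by (induction xs) (auto simp: less_le)
  then show ?thesis
    using convex_weights_bary[OF assms(2), of y] mcc_mset[of ?f]
    by (simp add: cc0_def bary_def convex_weights_mset[symmetric])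
qed

lemma cc_pair_eq_bary:
  assumes "0 < l" "l < 1"
  shows "cc [(l, a), (1 - l, b)] = bary UNIV (\<lambda>t. if t then l else 1 - l) (\<lambda>t. if t then a else b)"
  using mcc_pair[OF assms, of a b] assms by (simp add: bary_def UNIV_bool add_mset_commute)

end

section \<open>Random weights and measurability\<close>

text \<open>The random weight vector is rounded down to multiples of \<open>1/k\<close> in all coordinates but one.\<close>

lemma weights_discretize:
  fixes W :: "'i \<Rightarrow> 'w \<Rightarrow> real"
  assumes fin: "finite I" and W [measurable]: "\<And>i. i \<in> I \<Longrightarrow> W i \<in> borel_measurable N"
    and wt: "\<And>\<omega>. \<omega> \<in> space N \<Longrightarrow> weights_on I (\<lambda>i. W i \<omega>)" and \<epsilon>: "0 < \<epsilon>"
  obtains J V where "finite J" "V \<in> measurable N (count_space J)" "\<And>v. v \<in> J \<Longrightarrow> weights_on I v"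
    "\<And>\<omega> i. \<omega> \<in> space N \<Longrightarrow> i \<in> I \<Longrightarrow> \<bar>V \<omega> i - W i \<omega>\<bar> \<le> \<epsilon>"
proof (cases "space N = {}")
  case True
  then show thesis
    by (intro that[of "{}" "\<lambda>_ _. 0"]) (auto simp: measurable_empty_iff)
next
  case False
  then have "I \<noteq> {}" using wt by (fastforce simp: weights_on_def)
  then obtain i0 where i0: "i0 \<in> I" by auto
  \<comment> \<open>Each rounding loses at most \<open>1 / k\<close>, and the coordinate
    \<open>i0\<close> absorbs all the losses, at most \<open>card I / k\<close> in total.\<close>
  obtain k :: nat where k: "card I / \<epsilon> < k" using reals_Archimedean2 by blast
  have k0: "0 < k"
  proof -
    have "0 \<le> card I / \<epsilon>" using \<epsilon> by simp
    then show ?thesis using k by (meson le_less_trans of_nat_0_less_iff)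
  qed
  have k\<epsilon>: "card I / k \<le> \<epsilon>" using k k0 \<epsilon> by (simp add: field_simps)
  define r where "r \<omega> i = \<lfloor>k * W i \<omega>\<rfloor> / k" for \<omega> i
  define V0 where "V0 \<omega> i = (if i = i0 then 1 - (\<Sum>j\<in>I - {i0}. r \<omega> j) else r \<omega> i)" for \<omega> i
  \<comment> \<open>Restriction to \<open>I\<close> makes \<open>V \<omega>\<close> extensional: it
    is then determined by its values on \<open>I\<close> and ranges over a finite grid of
    functions.\<close>
  define V where "V \<omega> = restrict (V0 \<omega>) I" for \<omega>
  have W0: "0 \<le> W i \<omega>" "W i \<omega> \<le> 1" if "\<omega> \<in> space N" "i \<in> I" for \<omega> i
    using weights_onD(2)[OF wt[OF that(1)] that(2)] weights_on_le_1[OF wt[OF that(1)] that(2)] by auto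
  have r: "0 \<le> r \<omega> i" "r \<omega> i \<le> W i \<omega>" "W i \<omega> \<le> r \<omega> i + 1 / k" if "\<omega> \<in> space N" "i \<in> I" for \<omega> i
  proof -
    show "0 \<le> r \<omega> i" using W0(1)[OF that] by (simp add: r_def)
    have "real_of_int \<lfloor>k * W i \<omega>\<rfloor> \<le> k * W i \<omega>" by simp
    then show "r \<omega> i \<le> W i \<omega>" using k0 by (simp add: r_def field_simps)
    have "k * W i \<omega> \<le> real_of_int \<lfloor>k * W i \<omega>\<rfloor> + 1" by linarith
    then show "W i \<omega> \<le> r \<omega> i + 1 / k" using k0 by (simp add: r_def field_simps)
  qed
  have Wi0: "W i0 \<omega> = 1 - (\<Sum>j\<in>I - {i0}. W j \<omega>)" if "\<omega> \<in> space N" for \<omega>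
    using weights_onD(3)[OF wt[OF that]] fin i0 by (simp add: sum.remove[of I i0])
  have V0i0: "W i0 \<omega> \<le> V0 \<omega> i0" "V0 \<omega> i0 \<le> W i0 \<omega> + \<epsilon>" if \<omega>: "\<omega> \<in> space N" for \<omega>
  proof -
    have "(\<Sum>j\<in>I - {i0}. r \<omega> j) \<le> (\<Sum>j\<in>I - {i0}. W j \<omega>)"
      using r(2)[OF \<omega>] by (intro sum_mono) auto
    then show "W i0 \<omega> \<le> V0 \<omega> i0" using Wi0[OF \<omega>] by (simp add: V0_def)
    have "(\<Sum>j\<in>I - {i0}. W j \<omega>) \<le> (\<Sum>j\<in>I - {i0}. r \<omega> j + 1 / k)"
      using r(3)[OF \<omega>] by (intro sum_mono) auto
    also have "\<dots> = (\<Sum>j\<in>I - {i0}. r \<omega> j) + card (I - {i0}) / k"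
      by (simp add: sum.distrib)
    also have "card (I - {i0}) / real k \<le> card I / real k"
      using fin by (intro divide_right_mono) (auto intro!: card_mono)
    finally show "V0 \<omega> i0 \<le> W i0 \<omega> + \<epsilon>"
      using Wi0[OF \<omega>] k\<epsilon> by (simp add: V0_def)
  qed
  have "1 \<le> card I" using fin \<open>I \<noteq> {}\<close> by (simp add: Suc_le_eq card_gt_0_iff)
  then have "1 / real k \<le> card I / real k" using k0 by (simp add: divide_right_mono)
  then have "1 / k \<le> \<epsilon>" using k\<epsilon> by linarith
  then have close: "\<bar>V \<omega> i - W i \<omega>\<bar> \<le> \<epsilon>" if "\<omega> \<in> space N" "i \<in> I" for \<omega> i
    using V0i0[OF that(1)] r(2,3)[OF that] that(2) \<epsilon> by (cases "i = i0") (auto simp: V_def V0_def)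
  have wV: "weights_on I (V \<omega>)" if \<omega>: "\<omega> \<in> space N" for \<omega>
  proof -
    have "0 \<le> V \<omega> i" if "i \<in> I" for i
      using V0i0(1)[OF \<omega>] W0(1)[OF \<omega> i0] r(1)[OF \<omega> that] that by (cases "i = i0") (auto simp: V_def V0_def)
    moreover have "(\<Sum>i\<in>I. V \<omega> i) = 1"
    proof -
      have "(\<Sum>i\<in>I. V \<omega> i) = V0 \<omega> i0 + (\<Sum>i\<in>I - {i0}. V0 \<omega> i)"
        using fin i0 by (simp add: V_def sum.remove[of I i0])
      also have "(\<Sum>i\<in>I - {i0}. V0 \<omega> i) = (\<Sum>i\<in>I - {i0}. r \<omega> i)"
        by (intro sum.cong) (auto simp: V0_def)
      finally show ?thesis by (simp add: V0_def)
    qed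
    ultimately show ?thesis using fin by (simp add: weights_on_def)
  qed
  define J where "J = V ` space N"
  have "V \<omega> \<in> PiE I (\<lambda>_. (\<lambda>m::int. m / real k) ` {0..int k})" if \<omega>: "\<omega> \<in> space N" for \<omega>
  proof -
    have "V0 \<omega> i \<in> (\<lambda>m::int. m / real k) ` {0..int k}" if i: "i \<in> I" for i
    proof -
      have "\<exists>m::int. V0 \<omega> i = m / k"
      proof (cases "i = i0")
        case True
        have "V0 \<omega> i = of_int (int k - (\<Sum>j\<in>I - {i0}. \<lfloor>k * W j \<omega>\<rfloor>)) / k"
          using k0 True by (simp add: V0_def r_def diff_divide_distrib sum_divide_distrib)
        then show ?thesis by blast
      qed (auto simp: V0_def r_def)
      then obtain m :: int where m: "V0 \<omega> i = m / k" by blast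
      have "0 \<le> V0 \<omega> i" "V0 \<omega> i \<le> 1"
        using weights_onD(2)[OF wV[OF \<omega>] i] weights_on_le_1[OF wV[OF \<omega>] i] i by (auto simp: V_def)
      then have "0 \<le> m" "m \<le> k"
        using k0 by (auto simp: m zero_le_divide_iff divide_le_eq)
      then show ?thesis using m by auto
    qed
    then show ?thesis by (auto simp: V_def)
  qed
  then have "J \<subseteq> PiE I (\<lambda>_. (\<lambda>m::int. m / real k) ` {0..int k})"
    by (auto simp: J_def)
  then have finJ: "finite J"
    by (rule finite_subset) (use fin in \<open>auto intro!: finite_PiE\<close>)
  have "V \<in> measurable N (count_space J)"
    unfolding measurable_count_space_eq2[OF finJ]
  proof safe
    fix v assume "v \<in> J"
    then have "v \<in> extensional I" by (auto simp: J_def V_def)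
    then have "V -` {v} \<inter> space N = {\<omega>\<in>space N. \<forall>i\<in>I. V0 \<omega> i = v i}"
      by (auto simp: V_def intro!: extensionalityI[of _ I])
    also have "\<dots> \<in> sets N"
    proof (rule sets.sets_Collect_finite_All[OF _ fin])
      fix i assume "i \<in> I"
      have [measurable]: "(\<lambda>\<omega>. r \<omega> j) \<in> borel_measurable N" if "j \<in> I" for j
        unfolding r_def using W[OF that] by measurable
      have [measurable]: "(\<lambda>\<omega>. \<Sum>j\<in>I - {i0}. r \<omega> j) \<in> borel_measurable N"
        by (intro borel_measurable_sum) auto
      have [measurable]: "(\<lambda>\<omega>. V0 \<omega> i) \<in> borel_measurable N"
        unfolding V0_def using \<open>i \<in> I\<close> by measurable
      show "{\<omega>\<in>space N. V0 \<omega> i = v i} \<in> sets N" by measurable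
    qed
    finally show "V -` {v} \<inter> space N \<in> sets N" .
  qed (auto simp: J_def)
  then show thesis
    using that[OF finJ] wV close by (auto simp: J_def)
qed

locale cc_polish = cc_space cc for cc :: "(real \<times> 'a::polish_space) list \<Rightarrow> 'a"
begin

lemma measurable_K [measurable]: "K \<in> borel_measurable borel"
proof (rule borel_measurable_continuous_onI, rule continuous_at_imp_continuous_on, safe)
  fix x show "isCont K x"
    unfolding isCont_def tendsto_iff eventually_at using dist_K_le le_less_trans by blast
qed

text \<open>The pair is jointly continuous in \<open>(l, a, b)\<close> for \<open>0 < l < 1\<close>:
  \<open>cc_dist\<close> controls the points uniformly in \<open>l\<close>, and
  \<open>cc_continuous\<close> controls \<open>l\<close> for fixed points.\<close>

lemma measurable_cc_pair [measurable (raw)]: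
  assumes [measurable]: "\<xi> \<in> borel_measurable N" "f \<in> borel_measurable N" "g \<in> borel_measurable N"
    and \<xi>: "\<And>\<omega>. \<omega> \<in> space N \<Longrightarrow> 0 < \<xi> \<omega> \<and> \<xi> \<omega> < 1"
  shows "(\<lambda>\<omega>. cc [(\<xi> \<omega>, f \<omega>), (1 - \<xi> \<omega>, g \<omega>)]) \<in> borel_measurable N"
proof -
  define h where "h = (\<lambda>(l, a, b). cc [(l, a), (1 - l, b)])"
  define S where "S = {t :: real \<times> 'a \<times> 'a. 0 < fst t \<and> fst t < 1}"
  have "continuous_on S h"
    unfolding continuous_on_sequentially
  proof safe
    fix t :: "nat \<Rightarrow> real \<times> 'a \<times> 'a" and l a b
    assume lS: "(l, a, b) \<in> S" and tS: "\<forall>n. t n \<in> S" and t: "t \<longlonglongrightarrow> (l, a, b)"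
    define L A B where "L n = fst (t n)" and "A n = fst (snd (t n))" and "B n = snd (snd (t n))" for n
    have L: "L \<longlonglongrightarrow> l" and A: "A \<longlonglongrightarrow> a" and B: "B \<longlonglongrightarrow> b"
      unfolding L_def A_def B_def using t by (auto intro!: tendsto_eq_intros)
    have L01: "0 < L n" "L n < 1" for n using tS by (auto simp: S_def L_def)
    have l01: "0 < l" "l < 1" using lS by (auto simp: S_def)
    have h: "h (t n) = cc [(L n, A n), (1 - L n, B n)]" for n
      by (simp add: h_def L_def A_def B_def case_prod_unfold)
    have "(\<lambda>n. dist (A n) a + dist (B n) b + dist (cc [(L n, a), (1 - L n, b)]) (cc [(l, a), (1 - l, b)]))
        \<longlonglongrightarrow> 0 + 0 + 0"
      using A B cc_continuous[of L l a b] L L01 l01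
      by (intro tendsto_add tendsto_dist_iff[THEN iffD1]) auto
    then have "(\<lambda>n. dist (A n) a + dist (B n) b + dist (cc [(L n, a), (1 - L n, b)]) (cc [(l, a), (1 - l, b)]))
        \<longlonglongrightarrow> 0" by simp
    then have "(\<lambda>n. h (t n)) \<longlonglongrightarrow> h (l, a, b)"
    proof (rule metric_tendsto_imp_tendsto, intro always_eventually allI)
      fix n
      have "dist (h (t n)) (h (l, a, b)) \<le> dist (h (t n)) (cc [(L n, a), (1 - L n, b)]) +
          dist (cc [(L n, a), (1 - L n, b)]) (h (l, a, b))"
        by (rule dist_triangle)
      also have "dist (h (t n)) (cc [(L n, a), (1 - L n, b)]) \<le> L n * dist (A n) a + (1 - L n) * dist (B n) b"
        unfolding h by (rule cc_dist) (rule L01)+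
      also have "\<dots> \<le> 1 * dist (A n) a + 1 * dist (B n) b"
        using L01[of n] by (intro add_mono mult_right_mono) auto
      finally show "dist (h (t n)) (h (l, a, b)) \<le> dist (dist (A n) a + dist (B n) b +
          dist (cc [(L n, a), (1 - L n, b)]) (cc [(l, a), (1 - l, b)])) 0"
        by (simp add: h_def)
    qed
    then show "(h \<circ> t) \<longlonglongrightarrow> h (l, a, b)" by (simp add: comp_def)
  qed
  then have "h \<in> borel_measurable (restrict_space borel S)"
    by (rule borel_measurable_continuous_on_restrict)
  moreover have "(\<lambda>\<omega>. (\<xi> \<omega>, f \<omega>, g \<omega>)) \<in> measurable N (restrict_space borel S)"
    using \<xi> by (intro measurable_restrict_space2) (auto simp: S_def)
  ultimately have "(\<lambda>\<omega>. h (\<xi> \<omega>, f \<omega>, g \<omega>)) \<in> borel_measurable N"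
    by (rule measurable_compose_rev)
  then show ?thesis by (simp add: h_def)
qed

lemma dist_bary_weights_le':
  assumes "weights_on I w" "weights_on I v" "\<And>i. i \<in> I \<Longrightarrow> K (x i) = x i"
    and c: "K c = c" and wv: "\<And>i. i \<in> I \<Longrightarrow> \<bar>w i - v i\<bar> \<le> \<epsilon>"
  shows "dist (bary I w x) (bary I v x) \<le> \<epsilon> * (\<Sum>i\<in>I. dist (x i) c)"
proof -
  have "dist (bary I w x) (bary I v x) \<le> (\<Sum>i\<in>I. \<bar>w i - v i\<bar> * dist (x i) c)"
    by (rule dist_bary_weights_le) fact+
  also have "\<dots> \<le> \<epsilon> * (\<Sum>i\<in>I. dist (x i) c)"
    unfolding sum_distrib_left using wv by (intro sum_mono mult_right_mono) auto
  finally show ?thesis .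
qed

text \<open>With discretised weights the barycentre factors through a finite set and is measurable;
  \<open>dist_bary_weights_le'\<close> makes these approximations converge pointwise.\<close>

lemma measurable_bary:
  assumes fin: "finite I" and W: "\<And>i. i \<in> I \<Longrightarrow> W i \<in> borel_measurable N"
    and wt: "\<And>\<omega>. \<omega> \<in> space N \<Longrightarrow> weights_on I (\<lambda>i. W i \<omega>)"
    and x: "\<And>i. i \<in> I \<Longrightarrow> K (x i) = x i"
  shows "(\<lambda>\<omega>. bary I (\<lambda>i. W i \<omega>) x) \<in> borel_measurable N"
proof -
  have "\<exists>V J. finite J \<and> V \<in> measurable N (count_space J) \<and> (\<forall>v\<in>J. weights_on I v) \<and>
    (\<forall>\<omega>\<in>space N. \<forall>i\<in>I. \<bar>V \<omega> i - W i \<omega>\<bar> \<le> 1 / Suc n)" for n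
  proof -
    have "0 < 1 / real (Suc n)" by simp
    from weights_discretize[OF fin W wt this] show ?thesis by metis
  qed
  then obtain V J where VJ: "\<And>n. finite (J n)" "\<And>n. V n \<in> measurable N (count_space (J n))"
     "\<And>n v. v \<in> J n \<Longrightarrow> weights_on I v" "\<And>n \<omega> i. \<omega> \<in> space N \<Longrightarrow> i \<in> I \<Longrightarrow> \<bar>V n \<omega> i - W i \<omega>\<bar> \<le> 1 / Suc n"
    by metis
  show ?thesis
  proof (rule borel_measurable_LIMSEQ_metric)
    show "(\<lambda>\<omega>. bary I (V n \<omega>) x) \<in> borel_measurable N" for n
      by (rule measurable_compose[OF VJ(2)]) simp
    fix \<omega> assume \<omega>: "\<omega> \<in> space N"
    \<comment> \<open>\<open>K undefined\<close> is just some fixed point of \<open>K\<close>,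
      serving as the reference point \<open>c\<close>.\<close>
    have lim: "(\<lambda>n. 1 / real (Suc n) * (\<Sum>i\<in>I. dist (x i) (K undefined))) \<longlonglongrightarrow> 0"
      by (intro tendsto_mult_left_zero LIMSEQ_inverse_real_of_nat[unfolded inverse_eq_divide])
    show "(\<lambda>n. bary I (V n \<omega>) x) \<longlonglongrightarrow> bary I (\<lambda>i. W i \<omega>) x"
    proof (rule metric_tendsto_imp_tendsto[OF lim], intro always_eventually allI)
      fix n
      have "V n \<omega> \<in> J n" using measurable_space[OF VJ(2) \<omega>] by simp
      then have "dist (bary I (V n \<omega>) x) (bary I (\<lambda>i. W i \<omega>) x) \<le> 1 / Suc n * (\<Sum>i\<in>I. dist (x i) (K undefined))"
        by (intro dist_bary_weights_le' VJ(3)[of _ n] wt \<omega> x VJ(4)) auto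
      then show "dist (bary I (V n \<omega>) x) (bary I (\<lambda>i. W i \<omega>) x)
          \<le> dist (1 / Suc n * (\<Sum>i\<in>I. dist (x i) (K undefined))) 0"
        unfolding dist_norm diff_0_right real_norm_def by (rule order_trans[OF _ abs_ge_self])
    qed
  qed
qed

end

section \<open>Conditional expectation of simple random elements\<close>

lemma nearest_index:
  shows "nearest_index u n x \<le> n"
    and "j \<le> n \<Longrightarrow> dist (u (nearest_index u n x)) x \<le> dist (u j) x"
proof -
  let ?m = "Min ((\<lambda>j. dist (u j) x) ` {0..n})"
  have "?m \<in> (\<lambda>j. dist (u j) x) ` {0..n}" by (intro Min_in) auto
  then obtain i where "?m = dist (u i) x" "i \<in> {0..n}" by (rule imageE)
  then have "\<exists>i. i \<le> n \<and> dist (u i) x = ?m" by (intro exI[of _ i]) simp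
  then have *: "nearest_index u n x \<le> n \<and> dist (u (nearest_index u n x)) x = ?m"
    unfolding nearest_index_def by (rule LeastI_ex)
  show "nearest_index u n x \<le> n" using * by simp
  show "dist (u (nearest_index u n x)) x \<le> dist (u j) x" if "j \<le> n"
    using * that by (auto intro!: Min_le)
qed

lemma discretize_range: "discretize u n x \<in> u ` {..n}"
  using nearest_index(1)[of u n x] by (simp add: discretize_def)

lemma dist_discretize_le: "j \<le> n \<Longrightarrow> dist (discretize u n x) x \<le> dist (u j) x"
  unfolding discretize_def by (rule nearest_index)

lemma dist_discretize_antimono: "m \<le> n \<Longrightarrow> dist (discretize u n x) x \<le> dist (discretize u m x) x"
  unfolding discretize_def using nearest_index(1)[of u m x] by (intro nearest_index(2)) simp

lemma measurable_discretize [measurable]: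
  fixes u :: "nat \<Rightarrow> 'a::{metric_space, second_countable_topology}"
  shows "discretize u n \<in> borel_measurable borel"
proof -
  \<comment> \<open>Replacing the minimum by finitely many inequalities turns the index into a
    \<open>LEAST\<close> over measurable predicates.\<close>
  have Min: "dist (u i) x = Min ((\<lambda>j. dist (u j) x) ` {0..n}) \<longleftrightarrow> (\<forall>j\<in>{0..n}. dist (u i) x \<le> dist (u j) x)"
    if "i \<le> n" for i x
    using that by (subst eq_commute, subst Min_eq_iff) auto
  have "nearest_index u n = (\<lambda>x. LEAST i. i \<le> n \<and> (\<forall>j\<in>{0..n}. dist (u i) x \<le> dist (u j) x))"
    unfolding nearest_index_def using Min by (intro ext arg_cong[of _ _ Least]) auto
  then have "nearest_index u n \<in> borel \<rightarrow>\<^sub>M count_space UNIV" by simp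
  then show ?thesis unfolding discretize_def
    by (rule measurable_compose) simp
qed

lemma discretize_tendsto:
  assumes "closure (u ` {1..}) = UNIV"
  shows "(\<lambda>n. dist (discretize u n x) x) \<longlonglongrightarrow> 0"
  unfolding lim_sequentially
proof safe
  fix r :: real assume "0 < r"
  then obtain j where "dist (u j) x < r"
    using assms closure_approachable[of x "u ` {1..}"] by auto
  then show "\<exists>N. \<forall>n\<ge>N. dist (dist (discretize u n x) x) 0 < r"
    using dist_discretize_le[of j] by (force intro!: exI[of _ j] elim: le_less_trans)
qed

text \<open>By idempotence of \<open>K\<close>, membership of \<open>u 0\<close> in its range is the
  equation \<open>K (u 0) = u 0\<close>.\<close>

locale cc_prob = cc_polish cc + prob_space M
  for cc :: "(real \<times> 'a::polish_space) list \<Rightarrow> 'a" and M :: "'w measure" +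
  fixes u :: "nat \<Rightarrow> 'a"
  assumes K_u0: "K (u 0) = u 0" and dense: "closure (u ` {1..}) = UNIV"
begin

lemma cc_integrable_measurable: "cc_integrable M X \<Longrightarrow> X \<in> borel_measurable M"
  by (simp add: cc_integrable_def)

lemma cc_integrable_dist_const:
  fixes X :: "'w \<Rightarrow> 'a"
  assumes "cc_integrable M X" shows "integrable M (\<lambda>\<omega>. dist (X \<omega>) c)"
proof -
  note [measurable] = cc_integrable_measurable[OF assms]
  obtain v where v: "integrable M (\<lambda>\<omega>. dist v (X \<omega>))" using assms by (auto simp: cc_integrable_def)
  show ?thesis
  proof (rule Bochner_Integration.integrable_bound)
    show "integrable M (\<lambda>\<omega>. dist v (X \<omega>) + dist v c)" using v by simp
    show "AE \<omega> in M. norm (dist (X \<omega>) c) \<le> norm (dist v (X \<omega>) + dist v c)"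
      by (intro AE_I2) (simp add: dist_triangle3)
  qed simp
qed

lemma cc_integrable_dist:
  fixes X Y :: "'w \<Rightarrow> 'a"
  assumes "cc_integrable M X" "cc_integrable M Y" shows "integrable M (\<lambda>\<omega>. dist (X \<omega>) (Y \<omega>))"
proof -
  note [measurable] = assms[THEN cc_integrable_measurable]
  show ?thesis
  proof (rule Bochner_Integration.integrable_bound)
    show "integrable M (\<lambda>\<omega>. dist (X \<omega>) (u 0) + dist (Y \<omega>) (u 0))"
      by (intro Bochner_Integration.integrable_add cc_integrable_dist_const assms)
    show "AE \<omega> in M. norm (dist (X \<omega>) (Y \<omega>)) \<le> norm (dist (X \<omega>) (u 0) + dist (Y \<omega>) (u 0))"
      by (intro AE_I2) (simp add: dist_triangle2)
  qed simp
qed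

lemma cc_integrableI:
  fixes X :: "'w \<Rightarrow> 'a"
  assumes [measurable]: "X \<in> borel_measurable M" and "integrable M f" "AE \<omega> in M. dist (X \<omega>) c \<le> f \<omega>"
  shows "cc_integrable M X"
proof -
  have "integrable M (\<lambda>\<omega>. dist c (X \<omega>))"
    by (rule Bochner_Integration.integrable_bound[OF assms(2)]) (use assms(3) in \<open>auto simp: dist_commute\<close>)
  then show ?thesis using assms(1) by (auto simp: cc_integrable_def)
qed

lemma cc_integrable_finite:
  fixes X :: "'w \<Rightarrow> 'a"
  assumes "X \<in> borel_measurable M" "finite (X ` space M)"
  shows "cc_integrable M X"
proof (rule cc_integrableI[OF assms(1), of "\<lambda>_. \<Sum>x\<in>X ` space M. dist x (u 0)"])
  show "AE \<omega> in M. dist (X \<omega>) (u 0) \<le> (\<Sum>x\<in>X ` space M. dist x (u 0))"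
    using assms(2) by (intro AE_I2) (rule member_le_sum[of _ _ "\<lambda>x. dist x (u 0)"], auto)
qed simp

lemma finite_discretize: "finite ((\<lambda>\<omega>. discretize u n (X \<omega>)) ` S)"
  by (rule finite_subset[of _ "u ` {..n}"]) (use discretize_range in auto)

lemma cc_integrable_discretize:
  assumes "X \<in> borel_measurable M" shows "cc_integrable M (\<lambda>\<omega>. discretize u n (X \<omega>))"
  using assms finite_discretize by (intro cc_integrable_finite) auto

lemma simple_measurable:
  fixes X :: "'w \<Rightarrow> 'a"
  assumes [measurable]: "X \<in> borel_measurable M" and "finite (X ` space M)"
  shows "X \<in> measurable M (count_space (X ` space M))"
  unfolding measurable_count_space_eq2[OF assms(2)] by auto

lemma simple_values:
  assumes "finite (X ` space M)"
  shows "distinct (simple_values M X)" "set (simple_values M X) = X ` space M"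
proof -
  have "\<exists>xs. distinct xs \<and> set xs = X ` space M" using finite_distinct_list[OF assms] by auto
  then have "distinct (simple_values M X) \<and> set (simple_values M X) = X ` space M"
    unfolding simple_values_def by (rule someI_ex)
  then show "distinct (simple_values M X)" "set (simple_values M X) = X ` space M" by auto
qed

end

locale cc_subalg = cc_prob cc M u
  for cc :: "(real \<times> 'a::polish_space) list \<Rightarrow> 'a" and M :: "'w measure" and u +
  fixes G :: "'w measure"
  assumes subalg: "subalgebra M G"
begin

sublocale cond: sigma_finite_subalgebra M G
  by (intro finite_measure_subalgebra_is_sigma_finite finite_measure_subalgebra.intro
      finite_measure_subalgebra_axioms.intro subalg finite_measure_axioms)

abbreviation CE where "CE \<equiv> cc_cond_expectation cc u M G"
abbreviation SCE where "SCE \<equiv> simple_cond_expectation cc (u 0) M G"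
abbreviation RCE where "RCE \<equiv> real_cond_exp M G"

text \<open>The label map \<open>N\<close> may be finer than the random element under study: pairs
  of values and discretised weight vectors occur as labels below.\<close>

definition cprob :: "('w \<Rightarrow> 'i) \<Rightarrow> 'i \<Rightarrow> 'w \<Rightarrow> real" where
  "cprob N j = RCE (indicator (N -` {j} \<inter> space M))"

lemma measurable_cprob [measurable]: "cprob N j \<in> borel_measurable G" "cprob N j \<in> borel_measurable M"
  by (simp_all add: cprob_def)

lemma level_sets:
  assumes "finite J" "N \<in> measurable M (count_space J)"
  shows "N -` {j} \<inter> space M \<in> sets M"
proof (cases "j \<in> J")
  case True
  then show ?thesis using assms by (simp add: measurable_count_space_eq2)
next
  case False
  then have "N -` {j} \<inter> space M = {}" using measurable_space[OF assms(2)] by auto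
  then show ?thesis by simp
qed

lemma integrable_level_set:
  assumes "finite J" "N \<in> measurable M (count_space J)"
  shows "integrable M (indicator (N -` {j} \<inter> space M) :: 'w \<Rightarrow> real)"
  using level_sets[OF assms, of j] by (intro integrable_real_indicator) (auto simp: less_top[symmetric])

lemma cond_exp_finite_range:
  assumes J: "finite J" and N: "N \<in> measurable M (count_space J)"
  shows "AE \<omega> in M. RCE (\<lambda>\<omega>. f (N \<omega>)) \<omega> = (\<Sum>j\<in>J. f j * cprob N j \<omega>)"
proof -
  have int: "integrable M (\<lambda>\<omega>. f j * indicator (N -` {j} \<inter> space M) \<omega>)" for j
    using integrable_level_set[OF assms, of j] by simp
  have "AE \<omega> in M. \<forall>j\<in>J. RCE (\<lambda>\<omega>. f j * indicator (N -` {j} \<inter> space M) \<omega>) \<omega> = f j * cprob N j \<omega>"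
    unfolding cprob_def using J integrable_level_set[OF assms] by (intro AE_finite_allI cond.real_cond_exp_cmult)
  moreover have "AE \<omega> in M. RCE (\<lambda>\<omega>. \<Sum>j\<in>J. f j * indicator (N -` {j} \<inter> space M) \<omega>) \<omega>
     = (\<Sum>j\<in>J. RCE (\<lambda>\<omega>. f j * indicator (N -` {j} \<inter> space M) \<omega>) \<omega>)"
    by (rule cond.real_cond_exp_sum) (rule int)
  moreover have "AE \<omega> in M. RCE (\<lambda>\<omega>. f (N \<omega>)) \<omega> = RCE (\<lambda>\<omega>. \<Sum>j\<in>J. f j * indicator (N -` {j} \<inter> space M) \<omega>) \<omega>"
  proof (rule cond.real_cond_exp_cong)
    show "AE \<omega> in M. f (N \<omega>) = (\<Sum>j\<in>J. f j * indicator (N -` {j} \<inter> space M) \<omega>)"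
    proof (rule AE_I2)
      fix \<omega> assume \<omega>: "\<omega> \<in> space M"
      then have "(\<Sum>j\<in>J. f j * indicator (N -` {j} \<inter> space M) \<omega>) = (\<Sum>j\<in>J. if N \<omega> = j then f j else 0)"
        by (intro sum.cong) (auto simp: indicator_def)
      also have "\<dots> = f (N \<omega>)" using J measurable_space[OF N \<omega>] by simp
      finally show "f (N \<omega>) = (\<Sum>j\<in>J. f j * indicator (N -` {j} \<inter> space M) \<omega>)" by simp
    qed
    show "(\<lambda>\<omega>. f (N \<omega>)) \<in> borel_measurable M"
      by (rule measurable_compose[OF N]) simp
    show "(\<lambda>\<omega>. \<Sum>j\<in>J. f j * indicator (N -` {j} \<inter> space M) \<omega>) \<in> borel_measurable M"
      by (intro borel_measurable_sum borel_measurable_integrable int)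
  qed
  ultimately show ?thesis by eventually_elim simp
qed

lemma cprob_weights:
  assumes J: "finite J" and N: "N \<in> measurable M (count_space J)"
  shows "AE \<omega> in M. weights_on J (\<lambda>j. cprob N j \<omega>)"
proof -
  have "AE \<omega> in M. \<forall>j\<in>J. 0 \<le> cprob N j \<omega>"
    unfolding cprob_def using J level_sets[OF assms] by (intro AE_finite_allI cond.real_cond_exp_pos) auto
  moreover have "AE \<omega> in M. RCE (\<lambda>\<omega>. 1) \<omega> = 1"
    by (rule cond.real_cond_exp_F_meas) auto
  ultimately show ?thesis
    using cond_exp_finite_range[OF J N, of "\<lambda>_. 1"]
    by eventually_elim (use J in \<open>auto simp: weights_on_def\<close>)
qed

lemma SCE_eq:
  assumes "finite (X ` space M)"
  shows "SCE X \<omega> = (if weights_on (X ` space M) (\<lambda>x. cprob X x \<omega>)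
     then bary (X ` space M) (\<lambda>x. cprob X x \<omega>) K else u 0)"
proof -
  note sv = simple_values[OF assms]
  let ?ws = "map (\<lambda>x. (cprob X x \<omega>, K x)) (simple_values M X)"
  have "(\<forall>(l, u)\<in>set ?ws. 0 \<le> l) \<and> sum_list (map fst ?ws) = 1 \<longleftrightarrow>
     weights_on (X ` space M) (\<lambda>x. cprob X x \<omega>)"
    using assms sv by (auto simp: weights_on_def comp_def sum_list_distinct_conv_sum_set)
  moreover have "weights_on (X ` space M) (\<lambda>x. cprob X x \<omega>) \<Longrightarrow>
      cc0 cc ?ws = bary (X ` space M) (\<lambda>x. cprob X x \<omega>) K"
    using cc0_eq_bary[OF sv(1)] unfolding sv(2) by blast
  ultimately show ?thesis
    unfolding simple_cond_expectation_def Let_def cprob_def[symmetric] by auto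
qed

lemma K_SCE:
  assumes "finite (X ` space M)" shows "K (SCE X \<omega>) = SCE X \<omega>"
  by (auto simp: SCE_eq[OF assms] K_bary K_u0)

text \<open>\<open>measurable_bary\<close> and \<open>CE_bary\<close> ask for weight vectors at
  every point, while \<open>cprob\<close> provides them almost surely. On the exceptional set, which
  belongs to \<open>G\<close>, all mass is put on an arbitrary value \<open>v0\<close>.\<close>

lemma cprob_version:
  assumes fin: "finite (X ` space M)"
  obtains W where "\<And>v. W v \<in> borel_measurable G" "\<And>\<omega>. weights_on (X ` space M) (\<lambda>v. W v \<omega>)"
    "\<And>v \<omega>. weights_on (X ` space M) (\<lambda>x. cprob X x \<omega>) \<Longrightarrow> W v \<omega> = cprob X v \<omega>"
proof -
  let ?V = "X ` space M"
  have "?V \<noteq> {}" using not_empty by simp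
  then obtain v0 where v0: "v0 \<in> ?V" by auto
  define W where "W v \<omega> = (if weights_on ?V (\<lambda>x. cprob X x \<omega>) then cprob X v \<omega> else if v = v0 then 1 else 0)" for v \<omega>
  have [measurable]: "Measurable.pred G (\<lambda>\<omega>. weights_on ?V (\<lambda>x. cprob X x \<omega>))"
    by (rule pred_weights_on) simp
  show thesis
  proof (rule that)
    show "W v \<in> borel_measurable G" for v unfolding W_def by measurable
    show "weights_on ?V (\<lambda>i. W i \<omega>)" for \<omega>
      using weights_on_delta[OF fin v0]
      by (cases "weights_on ?V (\<lambda>x. cprob X x \<omega>)") (simp_all add: W_def)
  qed (simp add: W_def)
qed

lemma measurable_SCE:
  fixes X :: "'w \<Rightarrow> 'a"
  assumes fin: "finite (X ` space M)"
  shows "SCE X \<in> borel_measurable G"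
proof -
  let ?V = "X ` space M"
  obtain W where W: "\<And>v. W v \<in> borel_measurable G" "\<And>\<omega>. weights_on ?V (\<lambda>v. W v \<omega>)"
    "\<And>v \<omega>. weights_on ?V (\<lambda>x. cprob X x \<omega>) \<Longrightarrow> W v \<omega> = cprob X v \<omega>"
    using cprob_version[OF fin] by metis
  have [measurable]: "Measurable.pred G (\<lambda>\<omega>. weights_on ?V (\<lambda>x. cprob X x \<omega>))"
    by (rule pred_weights_on) simp
  have [measurable]: "(\<lambda>\<omega>. bary ?V (\<lambda>v. W v \<omega>) K) \<in> borel_measurable G"
    by (rule measurable_bary[OF fin]) (simp_all add: W)
  have "SCE X = (\<lambda>\<omega>. if weights_on ?V (\<lambda>x. cprob X x \<omega>) then bary ?V (\<lambda>v. W v \<omega>) K else u 0)"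
    by (auto simp: SCE_eq[OF fin] W(3) fun_eq_iff)
  then show ?thesis by simp
qed

text \<open>The conditional probability of a value is the sum over its labels, and
  \<open>bary_reindex\<close> undoes this summation. Hence any finite labelling that determines
  \<open>X\<close> may replace the level sets of \<open>X\<close>, which lets two simple elements
  share one partition.\<close>

lemma SCE_AE:
  assumes J: "finite J" and N: "N \<in> measurable M (count_space J)"
    and X: "\<And>\<omega>. \<omega> \<in> space M \<Longrightarrow> X \<omega> = g (N \<omega>)"
  shows "AE \<omega> in M. SCE X \<omega> = bary J (\<lambda>j. cprob N j \<omega>) (\<lambda>j. K (g j))"
proof -
  let ?V = "X ` space M" and ?W = "g ` J"
  have sub: "?V \<subseteq> ?W" using X measurable_space[OF N] by auto
  have finW: "finite ?W" using J by simp
  have finV: "finite ?V" by (rule finite_subset[OF sub finW])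
  have Xm: "X \<in> measurable M (count_space ?W)"
  proof -
    have "(\<lambda>\<omega>. g (N \<omega>)) \<in> measurable M (count_space ?W)"
      by (rule measurable_compose[OF N]) auto
    then show ?thesis by (subst measurable_cong[OF X]) auto
  qed
  have XmV: "X \<in> measurable M (count_space ?V)"
    using level_sets[OF finW Xm] by (simp add: measurable_count_space_eq2[OF finV])
  have "AE \<omega> in M. \<forall>v\<in>?W. cprob X v \<omega> = (\<Sum>j\<in>J. if g j = v then cprob N j \<omega> else 0)"
  proof (intro AE_finite_allI finW)
    fix v
    have "AE \<omega> in M. cprob X v \<omega> = RCE (\<lambda>\<omega>. of_bool (g (N \<omega>) = v)) \<omega>"
      unfolding cprob_def
    proof (rule cond.real_cond_exp_cong)
      show "AE \<omega> in M. indicator (X -` {v} \<inter> space M) \<omega> = (of_bool (g (N \<omega>) = v) :: real)"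
        by (intro AE_I2) (auto simp: X)
      show "(\<lambda>\<omega>. of_bool (g (N \<omega>) = v) :: real) \<in> borel_measurable M"
        by (rule measurable_compose[OF N]) simp
    qed (use level_sets[OF finW Xm] in simp)
    then show "AE \<omega> in M. cprob X v \<omega> = (\<Sum>j\<in>J. if g j = v then cprob N j \<omega> else 0)"
      using cond_exp_finite_range[OF J N, of "\<lambda>j. of_bool (g j = v)"]
      by eventually_elim (auto intro!: sum.cong)
  qed
  \<comment> \<open>Labels that never occur may contribute values outside the range of
    \<open>X\<close>; these have conditional probability 0 almost surely, so the index set can be
    enlarged from \<open>?V\<close> to \<open>?W\<close>.\<close>
  moreover have "AE \<omega> in M. \<forall>v\<in>?W - ?V. cprob X v \<omega> = 0"
  proof (rule AE_finite_allI)
    fix v assume "v \<in> ?W - ?V"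
    then have "X -` {v} \<inter> space M = {}" by blast
    moreover have "AE \<omega> in M. RCE (indicat_real {}) \<omega> = indicat_real {} \<omega>"
      by (rule cond.real_cond_exp_F_meas) auto
    ultimately show "AE \<omega> in M. cprob X v \<omega> = 0" by (simp add: cprob_def)
  qed (use finW in simp)
  ultimately show ?thesis
    using cprob_weights[OF J N] cprob_weights[OF finV XmV]
  proof eventually_elim
    case (elim \<omega>)
    have "SCE X \<omega> = bary ?V (\<lambda>x. cprob X x \<omega>) K"
      using elim SCE_eq[OF finV] by simp
    also have "\<dots> = bary ?W (\<lambda>x. cprob X x \<omega>) K"
      using elim finW sub by (intro bary_mono_neutral) auto
    also have "\<dots> = bary ?W (\<lambda>v. \<Sum>j\<in>J. if g j = v then cprob N j \<omega> else 0) K"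
      using elim by (intro bary_cong) auto
    also have "\<dots> = bary J (\<lambda>j. cprob N j \<omega>) (\<lambda>j. K (g j))"
      using elim finW by (intro bary_reindex[symmetric]) auto
    finally show ?case .
  qed
qed

text \<open>On the common partition given by the pair \<open>(X, Y)\<close> both barycentres have
  the same weights, so \<open>dist_bary_le\<close> applies, and \<open>K\<close> is
  nonexpansive.\<close>

lemma dist_SCE_le:
  assumes X: "X \<in> borel_measurable M" "finite (X ` space M)"
    and Y: "Y \<in> borel_measurable M" "finite (Y ` space M)"
  shows "AE \<omega> in M. dist (SCE X \<omega>) (SCE Y \<omega>) \<le> RCE (\<lambda>\<omega>. dist (X \<omega>) (Y \<omega>)) \<omega>"
proof -
  define N where "N \<omega> = (X \<omega>, Y \<omega>)" for \<omega>
  let ?J = "X ` space M \<times> Y ` space M"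
  have J: "finite ?J" using X Y by simp
  have N: "N \<in> measurable M (count_space ?J)"
    using X(1) Y(1) unfolding measurable_count_space_eq2[OF J] N_def by auto
  have "AE \<omega> in M. SCE X \<omega> = bary ?J (\<lambda>j. cprob N j \<omega>) (\<lambda>j. K (fst j))"
    by (rule SCE_AE[OF J N]) (simp add: N_def)
  moreover have "AE \<omega> in M. SCE Y \<omega> = bary ?J (\<lambda>j. cprob N j \<omega>) (\<lambda>j. K (snd j))"
    by (rule SCE_AE[OF J N]) (simp add: N_def)
  moreover have "AE \<omega> in M. RCE (\<lambda>\<omega>. dist (X \<omega>) (Y \<omega>)) \<omega> = (\<Sum>j\<in>?J. dist (fst j) (snd j) * cprob N j \<omega>)"
    using cond_exp_finite_range[OF J N, of "\<lambda>j. dist (fst j) (snd j)"] by (simp add: N_def)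
  ultimately show ?thesis
    using cprob_weights[OF J N]
  proof eventually_elim
    case (elim \<omega>)
    have "dist (SCE X \<omega>) (SCE Y \<omega>) \<le> (\<Sum>j\<in>?J. cprob N j \<omega> * dist (K (fst j)) (K (snd j)))"
      using elim dist_bary_le[of ?J "\<lambda>j. cprob N j \<omega>"] by simp
    also have "\<dots> \<le> (\<Sum>j\<in>?J. cprob N j \<omega> * dist (fst j) (snd j))"
      using elim by (intro sum_mono mult_left_mono dist_K_le) (auto simp: weights_on_def)
    finally show ?case using elim by (simp add: mult.commute)
  qed
qed

end

section \<open>Conditional expectation of integrable random elements\<close>

context cc_subalg
begin

lemma RCE_le_const:
  assumes "integrable M f" "\<And>\<omega>. \<omega> \<in> space M \<Longrightarrow> f \<omega> \<le> c"
  shows "AE \<omega> in M. RCE f \<omega> \<le> c"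
proof -
  have "AE \<omega> in M. RCE (\<lambda>_. c) \<omega> = c" by (rule cond.real_cond_exp_F_meas) auto
  moreover have "AE \<omega> in M. RCE f \<omega> \<le> RCE (\<lambda>_. c) \<omega>"
    using assms by (intro cond.real_cond_exp_mono) auto
  ultimately show ?thesis by eventually_elim simp
qed

lemma RCE_le_add:
  assumes "integrable M f" "integrable M g" "integrable M h"
    and "AE \<omega> in M. f \<omega> \<le> g \<omega> + h \<omega>"
  shows "AE \<omega> in M. RCE f \<omega> \<le> RCE g \<omega> + RCE h \<omega>"
  using cond.real_cond_exp_mono[OF assms(4,1)] cond.real_cond_exp_add[OF assms(2,3)] assms(2,3)
  by auto

definition err :: "('w \<Rightarrow> 'a) \<Rightarrow> nat \<Rightarrow> 'w \<Rightarrow> real" where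
  "err X n = RCE (\<lambda>\<omega>. dist (X \<omega>) (discretize u n (X \<omega>)))"

lemma integrable_dist_discretize:
  assumes "cc_integrable M X"
  shows "integrable M (\<lambda>\<omega>. dist (X \<omega>) (discretize u n (X \<omega>)))"
  by (intro cc_integrable_dist cc_integrable_discretize cc_integrable_measurable assms)

lemma err_nonneg:
  assumes "cc_integrable M X"
  shows "AE \<omega> in M. 0 \<le> err X n \<omega>"
  unfolding err_def using integrable_dist_discretize[OF assms] by (intro cond.real_cond_exp_pos) auto

text \<open>The distances decrease in \<open>n\<close> because the minimum runs over more points,
  and their integrals vanish by domination with \<open>dist (X \<omega>) (u 0)\<close>. So a
  subsequence tends to 0 almost surely, and monotonicity extends this to the whole sequence.\<close>

lemma err_tendsto:
  assumes X: "cc_integrable M X"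
  shows "AE \<omega> in M. (\<lambda>n. err X n \<omega>) \<longlonglongrightarrow> 0"
proof -
  let ?d = "\<lambda>n \<omega>. dist (X \<omega>) (discretize u n (X \<omega>))"
  note int = integrable_dist_discretize[OF X]
  have pos: "AE \<omega> in M. \<forall>n. 0 \<le> err X n \<omega>"
    using err_nonneg[OF X] by (simp add: AE_all_countable)
  have dec: "AE \<omega> in M. \<forall>n. err X (Suc n) \<omega> \<le> err X n \<omega>"
    unfolding AE_all_countable err_def
    by (intro allI cond.real_cond_exp_mono int AE_I2)
      (subst (1 2) dist_commute, rule dist_discretize_antimono, simp)
  have "(\<lambda>n. \<integral>\<omega>. ?d n \<omega> \<partial>M) \<longlonglongrightarrow> (\<integral>\<omega>. 0 \<partial>M)"
  proof (rule integral_dominated_convergence)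
    show "AE \<omega> in M. norm (?d n \<omega>) \<le> dist (X \<omega>) (u 0)" for n
      using dist_discretize_le[of 0 n u] by (intro AE_I2) (simp add: dist_commute)
    show "AE \<omega> in M. (\<lambda>n. ?d n \<omega>) \<longlonglongrightarrow> 0"
      using discretize_tendsto[OF dense] by (intro AE_I2) (simp add: dist_commute)
  qed (use int borel_measurable_integrable cc_integrable_dist_const[OF X] in auto)
  moreover have "(\<integral>\<omega>. norm (err X n \<omega>) \<partial>M) = (\<integral>\<omega>. ?d n \<omega> \<partial>M)" for n
  proof -
    have "(\<integral>\<omega>. norm (err X n \<omega>) \<partial>M) = (\<integral>\<omega>. err X n \<omega> \<partial>M)"
      using err_nonneg[OF X, of n] by (intro integral_cong_AE) (auto simp: err_def)
    then show ?thesis using cond.real_cond_exp_int(2)[OF int] by (simp add: err_def)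
  qed
  ultimately have lim: "(\<lambda>n. \<integral>\<omega>. norm (err X n \<omega>) \<partial>M) \<longlonglongrightarrow> 0" by simp
  have err_int: "integrable M (err X n)" for n
    unfolding err_def by (rule cond.real_cond_exp_int(1)[OF int])
  obtain r :: "nat \<Rightarrow> nat" where r: "strict_mono r" "AE \<omega> in M. (\<lambda>n. err X (r n) \<omega>) \<longlonglongrightarrow> 0"
    using tendsto_L1_AE_subseq[where u = "err X", OF err_int lim] by (elim exE conjE)
  show ?thesis
    using r(2) pos dec
  proof eventually_elim
    case (elim \<omega>)
    have "decseq (\<lambda>n. err X n \<omega>)" using elim by (simp add: decseq_Suc_iff)
    moreover have "\<forall>n. 0 \<le> err X n \<omega>" using elim by blast
    ultimately obtain L where L: "(\<lambda>n. err X n \<omega>) \<longlonglongrightarrow> L"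
      by (rule decseq_convergent)
    then have "(\<lambda>n. err X (r n) \<omega>) \<longlonglongrightarrow> L"
      using LIMSEQ_subseq_LIMSEQ[OF L r(1)] by (simp add: comp_def)
    then have "L = 0" using elim(1) by (rule LIMSEQ_unique)
    then show ?case using L by simp
  qed
qed

lemma dist_SCE_discretize_le:
  assumes X: "cc_integrable M X" and Y: "Y \<in> borel_measurable M" "finite (Y ` space M)"
  shows "AE \<omega> in M. dist (SCE (\<lambda>\<omega>. discretize u n (X \<omega>)) \<omega>) (SCE Y \<omega>)
    \<le> err X n \<omega> + RCE (\<lambda>\<omega>. dist (X \<omega>) (Y \<omega>)) \<omega>"
proof -
  note Xm [measurable] = cc_integrable_measurable[OF X]
  have "AE \<omega> in M. dist (SCE (\<lambda>\<omega>. discretize u n (X \<omega>)) \<omega>) (SCE Y \<omega>)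
    \<le> RCE (\<lambda>\<omega>. dist (discretize u n (X \<omega>)) (Y \<omega>)) \<omega>"
    by (rule dist_SCE_le[OF _ finite_discretize Y]) measurable
  moreover have "AE \<omega> in M. RCE (\<lambda>\<omega>. dist (discretize u n (X \<omega>)) (Y \<omega>)) \<omega>
    \<le> err X n \<omega> + RCE (\<lambda>\<omega>. dist (X \<omega>) (Y \<omega>)) \<omega>"
    unfolding err_def
    by (intro RCE_le_add cc_integrable_dist cc_integrable_discretize cc_integrable_finite Y Xm X AE_I2
        dist_triangle3)
  ultimately show ?thesis by eventually_elim simp
qed

text \<open>The distance of two approximations is at most the sum of their errors, so the sequence
  is Cauchy and completeness puts the definition of \<open>CE\<close> in its \<open>lim\<close>
  branch.\<close>

lemma SCE_tendsto_CE:
  assumes X: "cc_integrable M X"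
  shows "AE \<omega> in M. (\<lambda>n. SCE (\<lambda>\<omega>. discretize u n (X \<omega>)) \<omega>) \<longlonglongrightarrow> CE X \<omega>"
proof -
  note [measurable] = cc_integrable_measurable[OF X]
  have "AE \<omega> in M. dist (SCE (\<lambda>\<omega>. discretize u n (X \<omega>)) \<omega>) (SCE (\<lambda>\<omega>. discretize u m (X \<omega>)) \<omega>)
    \<le> err X n \<omega> + err X m \<omega>" for n m
    unfolding err_def[of X m] by (rule dist_SCE_discretize_le[OF X _ finite_discretize]) measurable
  then have "AE \<omega> in M. \<forall>n m. dist (SCE (\<lambda>\<omega>. discretize u n (X \<omega>)) \<omega>) (SCE (\<lambda>\<omega>. discretize u m (X \<omega>)) \<omega>)
    \<le> err X n \<omega> + err X m \<omega>"
    by (simp add: AE_all_countable)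
  with err_tendsto[OF X] show ?thesis
  proof eventually_elim
    case (elim \<omega>)
    let ?S = "\<lambda>n. SCE (\<lambda>\<omega>. discretize u n (X \<omega>)) \<omega>"
    have "Cauchy ?S"
    proof (rule metric_CauchyI)
      fix e :: real assume "0 < e"
      then obtain N where N: "\<And>n. n \<ge> N \<Longrightarrow> dist (err X n \<omega>) 0 < e / 2"
        using elim(1) unfolding lim_sequentially by (meson half_gt_zero)
      have "dist (?S m) (?S n) < e" if "m \<ge> N" "n \<ge> N" for m n
      proof -
        have "dist (?S m) (?S n) \<le> err X m \<omega> + err X n \<omega>" using elim(2) by blast
        then show ?thesis using N[OF that(1)] N[OF that(2)] by (auto simp: dist_real_def)
      qed
      then show "\<exists>N. \<forall>m\<ge>N. \<forall>n\<ge>N. dist (?S m) (?S n) < e" by blast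
    qed
    then have "convergent ?S" by (rule Cauchy_convergent)
    then show ?case
      by (simp add: cc_cond_expectation_def Let_def convergent_LIMSEQ_iff[symmetric])
  qed
qed

text \<open>Limit of the inequality for simple elements; the detour through the discretisations
  costs only \<open>err X n\<close> and \<open>err Y n\<close>.\<close>

lemma dist_CE_le:
  assumes X: "cc_integrable M X" and Y: "cc_integrable M Y"
  shows "AE \<omega> in M. dist (CE X \<omega>) (CE Y \<omega>) \<le> RCE (\<lambda>\<omega>. dist (X \<omega>) (Y \<omega>)) \<omega>"
proof -
  note Xm [measurable] = cc_integrable_measurable[OF X]
  note Ym [measurable] = cc_integrable_measurable[OF Y]
  have "AE \<omega> in M. dist (SCE (\<lambda>\<omega>. discretize u n (X \<omega>)) \<omega>) (SCE (\<lambda>\<omega>. discretize u n (Y \<omega>)) \<omega>)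
    \<le> err X n \<omega> + (err Y n \<omega> + RCE (\<lambda>\<omega>. dist (X \<omega>) (Y \<omega>)) \<omega>)" for n
  proof -
    have "AE \<omega> in M. RCE (\<lambda>\<omega>. dist (X \<omega>) (discretize u n (Y \<omega>))) \<omega> \<le> err Y n \<omega> + RCE (\<lambda>\<omega>. dist (X \<omega>) (Y \<omega>)) \<omega>"
      unfolding err_def
      by (intro RCE_le_add cc_integrable_dist cc_integrable_discretize Ym X Y AE_I2)
        (metis add.commute dist_triangle)
    moreover have "AE \<omega> in M. dist (SCE (\<lambda>\<omega>. discretize u n (X \<omega>)) \<omega>) (SCE (\<lambda>\<omega>. discretize u n (Y \<omega>)) \<omega>)
      \<le> err X n \<omega> + RCE (\<lambda>\<omega>. dist (X \<omega>) (discretize u n (Y \<omega>))) \<omega>"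
      by (rule dist_SCE_discretize_le[OF X _ finite_discretize]) measurable
    ultimately show ?thesis by eventually_elim simp
  qed
  then have "AE \<omega> in M. \<forall>n. dist (SCE (\<lambda>\<omega>. discretize u n (X \<omega>)) \<omega>) (SCE (\<lambda>\<omega>. discretize u n (Y \<omega>)) \<omega>)
    \<le> err X n \<omega> + (err Y n \<omega> + RCE (\<lambda>\<omega>. dist (X \<omega>) (Y \<omega>)) \<omega>)"
    by (simp add: AE_all_countable)
  with err_tendsto[OF X] err_tendsto[OF Y] SCE_tendsto_CE[OF X] SCE_tendsto_CE[OF Y] show ?thesis
  proof eventually_elim
    case (elim \<omega>)
    have "(\<lambda>n. err X n \<omega> + (err Y n \<omega> + RCE (\<lambda>\<omega>. dist (X \<omega>) (Y \<omega>)) \<omega>))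
       \<longlonglongrightarrow> 0 + (0 + RCE (\<lambda>\<omega>. dist (X \<omega>) (Y \<omega>)) \<omega>)"
      by (intro tendsto_add tendsto_const elim)
    from LIMSEQ_le[OF tendsto_dist[OF elim(3,4)] this] show ?case using elim(5) by simp
  qed
qed

text \<open>Common frame of the approximation arguments: countably many almost sure bounds hold
  simultaneously off one null set.\<close>

lemma AE_eq_if_dist_tendsto:
  fixes f g :: "'w \<Rightarrow> 'a"
  assumes "\<And>n :: nat. AE \<omega> in M. dist (f \<omega>) (g \<omega>) \<le> b n \<omega>" "AE \<omega> in M. (\<lambda>n. b n \<omega>) \<longlonglongrightarrow> 0"
  shows "AE \<omega> in M. f \<omega> = g \<omega>"
proof -
  have "AE \<omega> in M. \<forall>n. dist (f \<omega>) (g \<omega>) \<le> b n \<omega>"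
    using assms(1) by (simp add: AE_all_countable)
  with assms(2) show ?thesis
  proof eventually_elim
    case (elim \<omega>)
    have "dist (f \<omega>) (g \<omega>) \<le> 0"
      by (rule LIMSEQ_le_const[OF elim(1)]) (use elim(2) in auto)
    then show ?case by simp
  qed
qed

text \<open>Consistency of the two definitions. Compared with \<open>X\<close> itself, the
  \<open>n\<close>-th approximation is off by \<open>err X n\<close> plus a term that vanishes, so
  it also converges to \<open>SCE X\<close>.\<close>

lemma CE_simple:
  assumes X: "X \<in> borel_measurable M" "finite (X ` space M)"
  shows "AE \<omega> in M. CE X \<omega> = SCE X \<omega>"
proof -
  note Xi = cc_integrable_finite[OF X]
  have "AE \<omega> in M. RCE (\<lambda>\<omega>. dist (X \<omega>) (X \<omega>)) \<omega> = 0"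
    unfolding dist_self by (rule cond.real_cond_exp_F_meas) auto
  moreover have "AE \<omega> in M. \<forall>n. dist (SCE (\<lambda>\<omega>. discretize u n (X \<omega>)) \<omega>) (SCE X \<omega>)
      \<le> err X n \<omega> + RCE (\<lambda>\<omega>. dist (X \<omega>) (X \<omega>)) \<omega>"
    unfolding AE_all_countable by (intro allI dist_SCE_discretize_le[OF Xi X])
  ultimately show ?thesis
    using err_tendsto[OF Xi] SCE_tendsto_CE[OF Xi]
  proof eventually_elim
    case (elim \<omega>)
    have "dist (CE X \<omega>) (SCE X \<omega>) \<le> 0"
      by (rule LIMSEQ_le[OF tendsto_dist[OF elim(4) tendsto_const] elim(3)]) (use elim(1,2) in auto)
    then show ?case by simp
  qed
qed

text \<open>Fixed points of \<open>K\<close> are closed under limits, and the default value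
  \<open>u 0\<close> is one of them; hence there is no exceptional null set.\<close>

lemma K_CE [simp]: "K (CE X \<omega>) = CE X \<omega>"
proof -
  let ?S = "\<lambda>n. SCE (\<lambda>\<omega>. discretize u n (X \<omega>)) \<omega>"
  show ?thesis
  proof (cases "convergent ?S")
    case True
    then have L: "?S \<longlonglongrightarrow> CE X \<omega>"
      by (simp add: cc_cond_expectation_def Let_def convergent_LIMSEQ_iff[symmetric])
    have "(\<lambda>n. K (?S n)) \<longlonglongrightarrow> K (CE X \<omega>)"
      by (rule metric_tendsto_imp_tendsto[OF L]) (simp add: dist_K_le)
    then show ?thesis
      using L LIMSEQ_unique by (simp add: K_SCE[OF finite_discretize])
  next
    case False
    then show ?thesis by (simp add: cc_cond_expectation_def Let_def K_u0)
  qed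
qed

lemma measurable_CE: "CE X \<in> borel_measurable G"
proof -
  let ?S = "\<lambda>n \<omega>. SCE (\<lambda>\<omega>. discretize u n (X \<omega>)) \<omega>"
  have [measurable]: "?S n \<in> borel_measurable G" for n
    by (rule measurable_SCE[OF finite_discretize])
  \<comment> \<open>By completeness the convergence in the definition is the Cauchy property, which
    is a measurable condition.\<close>
  have [measurable]: "Measurable.pred G (\<lambda>\<omega>. Cauchy (\<lambda>n. ?S n \<omega>))"
    unfolding pred_def by (rule sets_Collect_Cauchy) measurable
  show ?thesis
  proof (rule borel_measurable_LIMSEQ_metric)
    show "(\<lambda>\<omega>. if Cauchy (\<lambda>n. ?S n \<omega>) then ?S n \<omega> else u 0) \<in> borel_measurable G" for n
      by measurable
    show "(\<lambda>n. if Cauchy (\<lambda>n. ?S n \<omega>) then ?S n \<omega> else u 0) \<longlonglongrightarrow> CE X \<omega>" for \<omega>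
      by (auto simp: cc_cond_expectation_def Let_def Cauchy_convergent_iff convergent_LIMSEQ_iff[symmetric])
  qed
qed

lemma measurable_CE_M: "CE X \<in> borel_measurable M"
  by (rule measurable_from_subalg[OF subalg measurable_CE])

text \<open>The level sets of the discretisations lie in \<open>G\<close>, so their conditional
  probabilities are indicators and the barycentre has all its mass at the actual value.\<close>

lemma CE_measurable:
  assumes X: "cc_integrable M X" and XG: "X \<in> borel_measurable G"
  shows "AE \<omega> in M. CE X \<omega> = K (X \<omega>)"
proof -
  have "AE \<omega> in M. SCE (\<lambda>\<omega>. discretize u n (X \<omega>)) \<omega> = K (discretize u n (X \<omega>))" for n
  proof -
    let ?Z = "\<lambda>\<omega>. discretize u n (X \<omega>)"
    have ZG: "?Z \<in> borel_measurable G" using XG by measurable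
    then have Z: "?Z \<in> borel_measurable M" by (rule measurable_from_subalg[OF subalg])
    let ?V = "?Z ` space M"
    have fin: "finite ?V" by (rule finite_discretize)
    have sp: "space G = space M" using subalg by (simp add: subalgebra_def)
    have "AE \<omega> in M. \<forall>v\<in>?V. cprob ?Z v \<omega> = indicator (?Z -` {v} \<inter> space M) \<omega>"
      unfolding cprob_def
    proof (intro AE_finite_allI fin cond.real_cond_exp_F_meas)
      fix v
      show "integrable M (indicat_real (?Z -` {v} \<inter> space M))"
        by (rule integrable_level_set[OF fin simple_measurable[OF Z fin]])
      have "?Z -` {v} \<inter> space G \<in> sets G" using ZG by (rule measurable_sets) simp
      then show "indicat_real (?Z -` {v} \<inter> space M) \<in> borel_measurable G"
        by (simp add: sp)
    qed
    moreover have "AE \<omega> in M. SCE ?Z \<omega> = bary ?V (\<lambda>v. cprob ?Z v \<omega>) (\<lambda>v. K v)"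
      by (rule SCE_AE[OF fin simple_measurable[OF Z fin]]) simp
    ultimately show ?thesis
      using AE_space
    proof eventually_elim
      case (elim \<omega>)
      have "bary ?V (\<lambda>v. cprob ?Z v \<omega>) K = bary ?V (\<lambda>v. if v = ?Z \<omega> then 1 else 0) K"
        using elim by (intro bary_cong) (auto simp: indicator_def)
      also have "\<dots> = K (?Z \<omega>)" using elim fin by (intro bary_delta) auto
      finally show ?case using elim by simp
    qed
  qed
  then have "AE \<omega> in M. \<forall>n. SCE (\<lambda>\<omega>. discretize u n (X \<omega>)) \<omega> = K (discretize u n (X \<omega>))"
    by (simp add: AE_all_countable)
  with SCE_tendsto_CE[OF X] show ?thesis
  proof eventually_elim
    case (elim \<omega>)
    have "(\<lambda>n. K (discretize u n (X \<omega>))) \<longlonglongrightarrow> K (X \<omega>)"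
      by (rule metric_tendsto_imp_tendsto[OF discretize_tendsto[OF dense, of "X \<omega>"]])
        (simp add: dist_K_le)
    then show ?case using elim LIMSEQ_unique by auto
  qed
qed

text \<open>The constant \<open>u 0\<close> is its own conditional expectation, so
  \<open>dist_CE_le\<close> bounds the distance to \<open>u 0\<close> by an integrable real
  conditional expectation.\<close>

lemma cc_integrable_CE:
  assumes X: "cc_integrable M X"
  shows "cc_integrable M (CE X)"
proof (rule cc_integrableI[OF measurable_CE_M])
  have c: "cc_integrable M (\<lambda>_. u 0)" by (auto simp: cc_integrable_def)
  show "integrable M (RCE (\<lambda>\<omega>. dist (X \<omega>) (u 0)))"
    by (intro cond.real_cond_exp_int cc_integrable_dist X c)
  have "AE \<omega> in M. CE (\<lambda>_. u 0) \<omega> = K (u 0)" by (rule CE_measurable[OF c]) simp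
  then show "AE \<omega> in M. dist (CE X \<omega>) (u 0) \<le> RCE (\<lambda>\<omega>. dist (X \<omega>) (u 0)) \<omega>"
    using dist_CE_le[OF X c] by eventually_elim (simp add: K_u0)
qed

text \<open>Needed because barycentre formulas for conditional expectations hold only almost surely
  and are then inserted under a further \<open>CE\<close>.\<close>

lemma CE_cong_AE:
  assumes X: "cc_integrable M X" and Y: "cc_integrable M Y" and eq: "AE \<omega> in M. X \<omega> = Y \<omega>"
  shows "AE \<omega> in M. CE X \<omega> = CE Y \<omega>"
proof -
  have "AE \<omega> in M. RCE (\<lambda>\<omega>. dist (X \<omega>) (Y \<omega>)) \<omega> = RCE (\<lambda>_. 0) \<omega>"
    by (rule cond.real_cond_exp_cong)
      (use eq borel_measurable_integrable[OF cc_integrable_dist[OF X Y]] in auto)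
  moreover have "AE \<omega> in M. RCE (\<lambda>_. 0) \<omega> = 0" by (rule cond.real_cond_exp_F_meas) auto
  ultimately show ?thesis
    using dist_CE_le[OF X Y] by eventually_elim simp
qed

lemma cc_integrable_K:
  assumes X: "cc_integrable M X"
  shows "cc_integrable M (\<lambda>\<omega>. K (X \<omega>))"
proof (rule cc_integrableI[where c = "K (u 0)", OF _ cc_integrable_dist_const[OF X, of "u 0"]])
  show "(\<lambda>\<omega>. K (X \<omega>)) \<in> borel_measurable M"
    using cc_integrable_measurable[OF X] by measurable
qed (simp add: dist_K_le)

text \<open>For a simple element the points \<open>K v\<close> become \<open>K (K v)\<close>, which
  changes nothing. The lemma allows a random element to be replaced by one with values in the range
  of \<open>K\<close>, where barycentres are associative.\<close>

lemma CE_K: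
  assumes X: "cc_integrable M X"
  shows "AE \<omega> in M. CE (\<lambda>\<omega>. K (X \<omega>)) \<omega> = CE X \<omega>"
proof (rule AE_eq_if_dist_tendsto[of _ _ "\<lambda>n \<omega>. err X n \<omega> + err X n \<omega>"])
  note Xm [measurable] = cc_integrable_measurable[OF X]
  fix n
  let ?Z = "\<lambda>\<omega>. discretize u n (X \<omega>)"
  let ?V = "?Z ` space M"
  have fin: "finite ?V" by (rule finite_discretize)
  have Z: "?Z \<in> borel_measurable M" by measurable
  have Zi: "cc_integrable M ?Z" by (rule cc_integrable_finite[OF Z fin])
  have finK: "finite ((\<lambda>\<omega>. K (?Z \<omega>)) ` space M)" using finite_imageI[OF fin, of K] by (simp add: image_image)
  have KZ: "(\<lambda>\<omega>. K (?Z \<omega>)) \<in> borel_measurable M" by measurable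
  have "AE \<omega> in M. SCE ?Z \<omega> = bary ?V (\<lambda>v. cprob ?Z v \<omega>) (\<lambda>v. K v)"
    by (rule SCE_AE[OF fin simple_measurable[OF Z fin]]) simp
  moreover have "AE \<omega> in M. SCE (\<lambda>\<omega>. K (?Z \<omega>)) \<omega> = bary ?V (\<lambda>v. cprob ?Z v \<omega>) (\<lambda>v. K (K v))"
    by (rule SCE_AE[OF fin simple_measurable[OF Z fin]]) simp
  moreover have "AE \<omega> in M. dist (CE (\<lambda>\<omega>. K (X \<omega>)) \<omega>) (CE (\<lambda>\<omega>. K (?Z \<omega>)) \<omega>) \<le> RCE (\<lambda>\<omega>. dist (K (X \<omega>)) (K (?Z \<omega>))) \<omega>"
    by (intro dist_CE_le cc_integrable_K X Zi)
  moreover have "AE \<omega> in M. RCE (\<lambda>\<omega>. dist (K (X \<omega>)) (K (?Z \<omega>))) \<omega> \<le> err X n \<omega>"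
    unfolding err_def
    by (intro cond.real_cond_exp_mono AE_I2 dist_K_le cc_integrable_dist cc_integrable_K X Zi)
  moreover have "AE \<omega> in M. dist (CE X \<omega>) (CE ?Z \<omega>) \<le> err X n \<omega>"
    unfolding err_def by (intro dist_CE_le X Zi)
  ultimately show "AE \<omega> in M. dist (CE (\<lambda>\<omega>. K (X \<omega>)) \<omega>) (CE X \<omega>) \<le> err X n \<omega> + err X n \<omega>"
    using CE_simple[OF Z fin] CE_simple[OF KZ finK]
  proof eventually_elim
    case (elim \<omega>)
    have "CE (\<lambda>\<omega>. K (?Z \<omega>)) \<omega> = CE ?Z \<omega>" using elim by simp
    then show ?case
      using elim(3,4,5) dist_triangle2[of "CE (\<lambda>\<omega>. K (X \<omega>)) \<omega>" "CE X \<omega>" "CE ?Z \<omega>"] by simp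
  qed
next
  show "AE \<omega> in M. (\<lambda>n. err X n \<omega> + err X n \<omega>) \<longlonglongrightarrow> 0"
    using err_tendsto[OF X] by eventually_elim (auto intro: tendsto_eq_intros)
qed

end

section \<open>Pairs as barycentres, and integrability of combinations with random weights\<close>

context cc_polish
begin

lemma cc_pair_bary:
  assumes "0 < l" "l < 1" "weights_on V a" "weights_on V b" "\<And>v. v \<in> V \<Longrightarrow> K (x v) = x v"
  shows "cc [(l, bary V a x), (1 - l, bary V b x)] = bary V (\<lambda>v. l * a v + (1 - l) * b v) x"
proof -
  let ?p = "\<lambda>t :: bool. if t then l else 1 - l"
  have "cc [(l, bary V a x), (1 - l, bary V b x)] = bary UNIV ?p (\<lambda>t. bary V (if t then a else b) x)"
    unfolding cc_pair_eq_bary[OF assms(1,2)] by (intro bary_cong) auto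
  also have "\<dots> = bary V (\<lambda>v. \<Sum>t\<in>UNIV. ?p t * (if t then a else b) v) x"
    by (intro bary_bary) (use assms in \<open>auto simp: weights_on_def UNIV_bool\<close>)
  also have "\<dots> = bary V (\<lambda>v. l * a v + (1 - l) * b v) x"
    by (simp add: UNIV_bool add.commute)
  finally show ?thesis .
qed

lemma K_cc_pair:
  assumes "0 < l" "l < 1"
  shows "K (cc [(l, a), (1 - l, b)]) = cc [(l, K a), (1 - l, K b)]"
proof -
  have "weights_on UNIV (\<lambda>t. if t then l else 1 - l)"
    using assms by (auto simp: weights_on_def UNIV_bool)
  then show ?thesis
    unfolding cc_pair_eq_bary[OF assms] by (subst K_bary) (auto intro!: bary_cong)
qed

lemma dist_bary_const_le:
  assumes w: "weights_on I w" and c: "K c = c"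
  shows "dist (bary I w x) c \<le> (\<Sum>i\<in>I. dist (x i) c)"
proof -
  have "dist (bary I w x) (bary I w (\<lambda>_. c)) \<le> (\<Sum>i\<in>I. w i * dist (x i) c)"
    by (rule dist_bary_le[OF w])
  also have "\<dots> \<le> (\<Sum>i\<in>I. 1 * dist (x i) c)"
    using weights_on_le_1[OF w] by (intro sum_mono mult_right_mono) auto
  finally show ?thesis by (simp add: bary_const[OF w c])
qed

end

context cc_prob
begin

lemma cc_integrable_bary:
  assumes "finite I" "\<And>i. i \<in> I \<Longrightarrow> W i \<in> borel_measurable M"
    and "\<And>\<omega>. \<omega> \<in> space M \<Longrightarrow> weights_on I (\<lambda>i. W i \<omega>)"
    and "\<And>i. i \<in> I \<Longrightarrow> K (x i) = x i"
  shows "cc_integrable M (\<lambda>\<omega>. bary I (\<lambda>i. W i \<omega>) x)"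
  by (rule cc_integrableI[OF measurable_bary, of I _ _ "\<lambda>_. \<Sum>i\<in>I. dist (x i) (u 0)" "u 0"])
    (auto simp: assms K_u0 intro!: AE_I2 dist_bary_const_le)

lemma cc_integrable_cc_pair:
  assumes X: "cc_integrable M X" and Y: "cc_integrable M Y" and \<xi>: "\<xi> \<in> borel_measurable M"
    and \<xi>01: "\<And>\<omega>. \<omega> \<in> space M \<Longrightarrow> 0 < \<xi> \<omega> \<and> \<xi> \<omega> < 1"
  shows "cc_integrable M (\<lambda>\<omega>. cc [(\<xi> \<omega>, X \<omega>), (1 - \<xi> \<omega>, Y \<omega>)])"
proof (rule cc_integrableI)
  note [measurable] = X[THEN cc_integrable_measurable] Y[THEN cc_integrable_measurable] \<xi>
  show "(\<lambda>\<omega>. cc [(\<xi> \<omega>, X \<omega>), (1 - \<xi> \<omega>, Y \<omega>)]) \<in> borel_measurable M"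
    by (rule measurable_cc_pair) (auto simp: \<xi>01)
  show "integrable M (\<lambda>\<omega>. dist (X \<omega>) (u 0) + dist (Y \<omega>) (u 0))"
    by (intro Bochner_Integration.integrable_add cc_integrable_dist_const X Y)
  show "AE \<omega> in M. dist (cc [(\<xi> \<omega>, X \<omega>), (1 - \<xi> \<omega>, Y \<omega>)]) (u 0) \<le> dist (X \<omega>) (u 0) + dist (Y \<omega>) (u 0)"
  proof (rule AE_I2)
    fix \<omega> assume "\<omega> \<in> space M"
    then have \<xi>: "0 < \<xi> \<omega>" "\<xi> \<omega> < 1" using \<xi>01 by auto
    \<comment> \<open>By \<open>cc_pair_K\<close> the constant \<open>u 0\<close> is a combination
      of two copies of itself, with the same random weights.\<close>
    have "dist (cc [(\<xi> \<omega>, X \<omega>), (1 - \<xi> \<omega>, Y \<omega>)]) (u 0)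
      = dist (cc [(\<xi> \<omega>, X \<omega>), (1 - \<xi> \<omega>, Y \<omega>)]) (cc [(\<xi> \<omega>, u 0), (1 - \<xi> \<omega>, u 0)])"
      using cc_pair_K[OF \<xi>, of "u 0"] by (simp add: K_u0)
    also have "\<dots> \<le> \<xi> \<omega> * dist (X \<omega>) (u 0) + (1 - \<xi> \<omega>) * dist (Y \<omega>) (u 0)"
      by (rule cc_dist[OF \<xi>])
    also have "\<dots> \<le> 1 * dist (X \<omega>) (u 0) + 1 * dist (Y \<omega>) (u 0)"
      using \<xi> by (intro add_mono mult_right_mono) auto
    finally show "dist (cc [(\<xi> \<omega>, X \<omega>), (1 - \<xi> \<omega>, Y \<omega>)]) (u 0) \<le> dist (X \<omega>) (u 0) + dist (Y \<omega>) (u 0)"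
      by simp
  qed
qed

end

section \<open>Conditional expectation of barycentres with random weights\<close>

context cc_subalg
begin

lemma RCE_close:
  assumes f: "integrable M f" and g: "integrable M g" and "\<And>\<omega>. \<omega> \<in> space M \<Longrightarrow> \<bar>f \<omega> - g \<omega>\<bar> \<le> \<epsilon>"
  shows "AE \<omega> in M. \<bar>RCE f \<omega> - RCE g \<omega>\<bar> \<le> \<epsilon>"
proof -
  have "AE \<omega> in M. RCE (\<lambda>\<omega>. f \<omega> - g \<omega>) \<omega> \<le> \<epsilon>" "AE \<omega> in M. RCE (\<lambda>\<omega>. g \<omega> - f \<omega>) \<omega> \<le> \<epsilon>"
    using assms by (auto intro!: RCE_le_const simp: abs_le_iff)
  then show ?thesis
    using cond.real_cond_exp_diff[OF f g] cond.real_cond_exp_diff[OF g f]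
    by eventually_elim (simp add: abs_le_iff)
qed

lemma integrable_weight:
  assumes "W i \<in> borel_measurable M" "\<And>\<omega>. \<omega> \<in> space M \<Longrightarrow> weights_on I (\<lambda>i. W i \<omega>)" "i \<in> I"
  shows "integrable M (W i)"
proof (rule integrable_const_bound[where B = 1])
  show "AE \<omega> in M. norm (W i \<omega>) \<le> 1"
    using weights_onD(2)[OF assms(2) assms(3)] weights_on_le_1[OF assms(2) assms(3)]
    by (intro AE_I2) auto
qed (rule assms)

lemma RCE_weights:
  assumes I: "finite I" and W: "\<And>i. i \<in> I \<Longrightarrow> W i \<in> borel_measurable M"
    and wt: "\<And>\<omega>. \<omega> \<in> space M \<Longrightarrow> weights_on I (\<lambda>i. W i \<omega>)"
  shows "AE \<omega> in M. weights_on I (\<lambda>i. RCE (W i) \<omega>)"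
proof -
  \<comment> \<open>The summation rule is applied with integrability at every index, so the weights
    are set to 0 outside \<open>I\<close>.\<close>
  define W' where "W' i = (if i \<in> I then W i else (\<lambda>_. 0))" for i
  have int: "integrable M (W' i)" for i
    using integrable_weight[OF W wt] by (auto simp: W'_def)
  have "AE \<omega> in M. RCE (\<lambda>\<omega>. \<Sum>i\<in>I. W' i \<omega>) \<omega> = (\<Sum>i\<in>I. RCE (W' i) \<omega>)"
    by (rule cond.real_cond_exp_sum[OF int])
  moreover have "AE \<omega> in M. RCE (\<lambda>\<omega>. \<Sum>i\<in>I. W' i \<omega>) \<omega> = RCE (\<lambda>_. 1) \<omega>"
  proof (rule cond.real_cond_exp_cong)
    show "AE \<omega> in M. (\<Sum>i\<in>I. W' i \<omega>) = 1"
      using weights_onD(3)[OF wt] by (intro AE_I2) (simp add: W'_def)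
    show "(\<lambda>\<omega>. \<Sum>i\<in>I. W' i \<omega>) \<in> borel_measurable M"
      by (intro borel_measurable_sum borel_measurable_integrable int)
  qed simp
  moreover have "AE \<omega> in M. RCE (\<lambda>_. 1) \<omega> = 1" by (rule cond.real_cond_exp_F_meas) auto
  moreover have "AE \<omega> in M. \<forall>i\<in>I. 0 \<le> RCE (W i) \<omega>"
    using weights_onD(2)[OF wt] by (intro AE_finite_allI I cond.real_cond_exp_pos W AE_I2) auto
  ultimately show ?thesis
    by eventually_elim (use I in \<open>auto simp: weights_on_def W'_def\<close>)
qed

text \<open>Discretizing the weights reduces the claim to the associativity of barycentres.\<close>

lemma CE_bary:
  assumes I: "finite I" and W: "\<And>i. i \<in> I \<Longrightarrow> W i \<in> borel_measurable M"
    and wt: "\<And>\<omega>. \<omega> \<in> space M \<Longrightarrow> weights_on I (\<lambda>i. W i \<omega>)"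
    and x: "\<And>i. i \<in> I \<Longrightarrow> K (x i) = x i"
  shows "AE \<omega> in M. CE (\<lambda>\<omega>. bary I (\<lambda>i. W i \<omega>) x) \<omega> = bary I (\<lambda>i. RCE (W i) \<omega>) x"
proof (rule AE_eq_if_dist_tendsto)
  let ?D = "\<Sum>i\<in>I. dist (x i) (u 0)"
  \<comment> \<open>The error is paid twice: for replacing \<open>W\<close> by its discretisation
    under \<open>CE\<close>, and for replacing the conditional means of the discretised weights by
    those of \<open>W\<close> in the barycentre.\<close>
  show "AE \<omega> in M. (\<lambda>n. 2 * (1 / real (Suc n) * ?D)) \<longlonglongrightarrow> 0"
    by (intro AE_I2 tendsto_mult_right_zero tendsto_mult_left_zero
        LIMSEQ_inverse_real_of_nat[unfolded inverse_eq_divide])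
  fix n :: nat
  define \<epsilon> where "\<epsilon> = 1 / real (Suc n)"
  have "0 < \<epsilon>" by (simp add: \<epsilon>_def)
  then obtain J V where J: "finite J" and V: "V \<in> measurable M (count_space J)"
    and Jw: "\<And>v. v \<in> J \<Longrightarrow> weights_on I v"
    and VW: "\<And>\<omega> i. \<omega> \<in> space M \<Longrightarrow> i \<in> I \<Longrightarrow> \<bar>V \<omega> i - W i \<omega>\<bar> \<le> \<epsilon>"
    using weights_discretize[OF I W wt] by metis
  have Vw: "weights_on I (\<lambda>i. V \<omega> i)" if "\<omega> \<in> space M" for \<omega>
    using Jw measurable_space[OF V that] by auto
  have Vm: "(\<lambda>\<omega>. V \<omega> i) \<in> borel_measurable M" for i
    by (rule measurable_compose[OF V]) simp
  let ?Z = "\<lambda>\<omega>. bary I (\<lambda>i. W i \<omega>) x" and ?Z' = "\<lambda>\<omega>. bary I (V \<omega>) x"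
  have Zi: "cc_integrable M ?Z" by (rule cc_integrable_bary) fact+
  have Zi': "cc_integrable M ?Z'"
    using cc_integrable_bary[of I "\<lambda>i \<omega>. V \<omega> i" x] I Vm Vw x by simp
  have "?Z' ` space M \<subseteq> (\<lambda>v. bary I v x) ` J"
    using measurable_space[OF V] by auto
  then have fin: "finite (?Z' ` space M)"
    by (rule finite_subset) (use J in simp)
  have RW: "AE \<omega> in M. weights_on I (\<lambda>i. RCE (W i) \<omega>)"
    by (rule RCE_weights) (use I W wt in auto)
  \<comment> \<open>The discretised weight vector is its own label: where \<open>V\<close> equals
    \<open>v\<close>, the random element is the constant \<open>bary I v x\<close>.\<close>
  have "AE \<omega> in M. SCE ?Z' \<omega> = bary J (\<lambda>v. cprob V v \<omega>) (\<lambda>v. K (bary I v x))"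
    by (rule SCE_AE[OF J V]) simp
  moreover have "AE \<omega> in M. \<forall>i\<in>I. RCE (\<lambda>\<omega>. V \<omega> i) \<omega> = (\<Sum>v\<in>J. v i * cprob V v \<omega>)"
    by (intro AE_finite_allI I cond_exp_finite_range[OF J V, of "\<lambda>v. v _"])
  moreover have "AE \<omega> in M. \<forall>i\<in>I. \<bar>RCE (\<lambda>\<omega>. V \<omega> i) \<omega> - RCE (W i) \<omega>\<bar> \<le> \<epsilon>"
    using integrable_weight[OF W wt] integrable_weight[of "\<lambda>i \<omega>. V \<omega> i", OF Vm Vw] VW
    by (intro AE_finite_allI I RCE_close) auto
  moreover have "AE \<omega> in M. RCE (\<lambda>\<omega>. dist (?Z \<omega>) (?Z' \<omega>)) \<omega> \<le> \<epsilon> * ?D"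
  proof (rule RCE_le_const[OF cc_integrable_dist[OF Zi Zi']])
    fix \<omega> assume "\<omega> \<in> space M"
    then show "dist (?Z \<omega>) (?Z' \<omega>) \<le> \<epsilon> * ?D"
      using VW by (intro dist_bary_weights_le' wt Vw x K_u0) (auto simp: abs_minus_commute)
  qed
  ultimately show "AE \<omega> in M. dist (CE ?Z \<omega>) (bary I (\<lambda>i. RCE (W i) \<omega>) x) \<le> 2 * (1 / real (Suc n) * ?D)"
    using dist_CE_le[OF Zi Zi'] CE_simple[OF cc_integrable_measurable[OF Zi'] fin] cprob_weights[OF J V]
      RW
  proof eventually_elim
    case (elim \<omega>)
    have "CE ?Z' \<omega> = bary J (\<lambda>v. cprob V v \<omega>) (\<lambda>v. bary I v x)"
      unfolding elim(6) elim(1)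
      by (intro bary_cong refl) (use K_bary[OF Jw] x in \<open>auto intro!: bary_cong\<close>)
    also have "\<dots> = bary I (\<lambda>i. \<Sum>v\<in>J. cprob V v \<omega> * v i) x"
      using elim(7) Jw x by (intro bary_bary) auto
    also have "\<dots> = bary I (\<lambda>i. RCE (\<lambda>\<omega>. V \<omega> i) \<omega>) x"
      using elim(2) by (intro bary_cong) (auto simp: mult.commute)
    finally have CEZ': "CE ?Z' \<omega> = bary I (\<lambda>i. RCE (\<lambda>\<omega>. V \<omega> i) \<omega>) x" .
    have "weights_on I (\<lambda>i. \<Sum>v\<in>J. cprob V v \<omega> * v i)"
      using elim(7) Jw by (intro weights_on_mix) auto
    then have "weights_on I (\<lambda>i. RCE (\<lambda>\<omega>. V \<omega> i) \<omega>)"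
      using elim(2) by (simp add: weights_on_def mult.commute)
    then have "dist (CE ?Z' \<omega>) (bary I (\<lambda>i. RCE (W i) \<omega>) x) \<le> \<epsilon> * ?D"
      unfolding CEZ' using elim(3,8) by (intro dist_bary_weights_le' x K_u0) auto
    then show ?case
      using elim(4,5) dist_triangle[of "CE ?Z \<omega>" "bary I (\<lambda>i. RCE (W i) \<omega>) x" "CE ?Z' \<omega>"]
      unfolding \<epsilon>_def by linarith
  qed
qed

text \<open>Lets two simple elements be expanded over one and the same set of values, as
  \<open>CE_cc_pair_simple\<close> requires.\<close>

lemma SCE_AE_superset:
  assumes X: "X \<in> borel_measurable M" and V: "finite V" "X ` space M \<subseteq> V"
  shows "AE \<omega> in M. SCE X \<omega> = bary V (\<lambda>v. cprob X v \<omega>) K"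
    and "AE \<omega> in M. weights_on V (\<lambda>v. cprob X v \<omega>)"
proof -
  have "X \<in> measurable M (count_space V)"
    using X V by (auto simp: measurable_count_space_eq2)
  then show "AE \<omega> in M. SCE X \<omega> = bary V (\<lambda>v. cprob X v \<omega>) K"
    "AE \<omega> in M. weights_on V (\<lambda>v. cprob X v \<omega>)"
    using SCE_AE[OF V(1), of X X "\<lambda>v. v"] cprob_weights[OF V(1)] by auto
qed

end

section \<open>Tower property, convex combinations and independence\<close>

context cc_prob
begin

text \<open>On the weights of a simple element the claim is the tower property of real conditional
  probabilities. The same real property, applied to the distance bound, shows that the
  discretisation error after two conditional expectations is at most
  \<open>A.err X n\<close>.\<close>

lemma CE_tower:
  assumes G2: "subalgebra M G2" and G1: "subalgebra M G1" and sub: "sets G1 \<subseteq> sets G2"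
    and X: "cc_integrable M X"
  shows "AE \<omega> in M. cc_cond_expectation cc u M G1 (cc_cond_expectation cc u M G2 X) \<omega>
    = cc_cond_expectation cc u M G1 X \<omega>"
proof -
  interpret A: cc_subalg cc M u G1 by unfold_locales (rule G1)
  interpret B: cc_subalg cc M u G2 by unfold_locales (rule G2)
  have G12: "subalgebra G2 G1"
    using G1 G2 sub by (simp add: subalgebra_def)
  note Xm [measurable] = cc_integrable_measurable[OF X]
  have simple: "AE \<omega> in M. A.CE (B.CE Z) \<omega> = A.CE Z \<omega>"
    if Z: "Z \<in> borel_measurable M" and fin: "finite (Z ` space M)" for Z
  proof -
    let ?V = "Z ` space M"
    have Zc: "Z \<in> measurable M (count_space ?V)" by (rule simple_measurable[OF Z fin])
    obtain W where WG: "\<And>v. W v \<in> borel_measurable G2"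
      and Ww: "\<And>\<omega>. weights_on ?V (\<lambda>v. W v \<omega>)"
      and W: "\<And>v \<omega>. weights_on ?V (\<lambda>x. B.cprob Z x \<omega>) \<Longrightarrow> W v \<omega> = B.cprob Z v \<omega>"
      using B.cprob_version[OF fin] by metis
    have Wm: "W v \<in> borel_measurable M" for v by (rule measurable_from_subalg[OF G2 WG])
    have W_eq: "AE \<omega> in M. \<forall>v. W v \<omega> = B.cprob Z v \<omega>"
      using B.cprob_weights[OF fin Zc] by eventually_elim (simp add: W)
    let ?Y = "\<lambda>\<omega>. bary ?V (\<lambda>v. W v \<omega>) K"
    have Yi: "cc_integrable M ?Y" by (rule cc_integrable_bary[OF fin Wm Ww]) simp
    have "AE \<omega> in M. B.CE Z \<omega> = ?Y \<omega>"
      using B.CE_simple[OF Z fin] B.SCE_AE_superset(1)[OF Z fin order_refl] W_eq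
      by eventually_elim simp
    then have "AE \<omega> in M. A.CE (B.CE Z) \<omega> = A.CE ?Y \<omega>"
      by (intro A.CE_cong_AE B.cc_integrable_CE cc_integrable_finite Z fin Yi)
    moreover have "AE \<omega> in M. A.CE ?Y \<omega> = bary ?V (\<lambda>v. A.RCE (W v) \<omega>) K"
      by (rule A.CE_bary[OF fin Wm Ww]) simp
    moreover have "AE \<omega> in M. \<forall>v\<in>?V. A.RCE (W v) \<omega> = A.cprob Z v \<omega>"
    proof (intro AE_finite_allI fin)
      fix v
      have "AE \<omega> in M. A.RCE (W v) \<omega> = A.RCE (B.cprob Z v) \<omega>"
        by (rule A.cond.real_cond_exp_cong[OF _ Wm]) (use W_eq in auto)
      moreover have "AE \<omega> in M. A.RCE (B.cprob Z v) \<omega> = A.cprob Z v \<omega>"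
        unfolding B.cprob_def A.cprob_def
        by (rule A.cond.real_cond_exp_nested_subalg[OF G2 G12 A.integrable_level_set[OF fin Zc]])
      ultimately show "AE \<omega> in M. A.RCE (W v) \<omega> = A.cprob Z v \<omega>" by eventually_elim simp
    qed
    ultimately show ?thesis
      using A.CE_simple[OF Z fin] A.SCE_AE_superset(1)[OF Z fin order_refl]
    proof eventually_elim
      case (elim \<omega>)
      have "bary ?V (\<lambda>v. A.RCE (W v) \<omega>) K = bary ?V (\<lambda>v. A.cprob Z v \<omega>) K"
        using elim(3) by (intro bary_cong) auto
      then show ?case using elim by simp
    qed
  qed
  show ?thesis
  proof (rule A.AE_eq_if_dist_tendsto)
    show "AE \<omega> in M. (\<lambda>n. A.err X n \<omega> + A.err X n \<omega>) \<longlonglongrightarrow> 0"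
      using A.err_tendsto[OF X] by eventually_elim (auto intro: tendsto_eq_intros)
    fix n
    let ?Z = "\<lambda>\<omega>. discretize u n (X \<omega>)"
    have Z: "?Z \<in> borel_measurable M" by measurable
    have fin: "finite (?Z ` space M)" by (rule finite_discretize)
    have Zi: "cc_integrable M ?Z" by (rule cc_integrable_finite[OF Z fin])
    have int: "integrable M (\<lambda>\<omega>. dist (X \<omega>) (?Z \<omega>))" by (rule cc_integrable_dist[OF X Zi])
    have "AE \<omega> in M. dist (A.CE (B.CE X) \<omega>) (A.CE (B.CE ?Z) \<omega>) \<le> A.RCE (\<lambda>\<omega>. dist (B.CE X \<omega>) (B.CE ?Z \<omega>)) \<omega>"
      by (intro A.dist_CE_le B.cc_integrable_CE X Zi)
    moreover have "AE \<omega> in M. A.RCE (\<lambda>\<omega>. dist (B.CE X \<omega>) (B.CE ?Z \<omega>)) \<omega> \<le> A.RCE (B.RCE (\<lambda>\<omega>. dist (X \<omega>) (?Z \<omega>))) \<omega>"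
      by (intro A.cond.real_cond_exp_mono B.dist_CE_le cc_integrable_dist B.cc_integrable_CE X Zi
          B.cond.real_cond_exp_int int)
    moreover have "AE \<omega> in M. A.RCE (B.RCE (\<lambda>\<omega>. dist (X \<omega>) (?Z \<omega>))) \<omega> = A.err X n \<omega>"
      unfolding A.err_def by (rule A.cond.real_cond_exp_nested_subalg[OF G2 G12 int])
    moreover have "AE \<omega> in M. dist (A.CE X \<omega>) (A.CE ?Z \<omega>) \<le> A.err X n \<omega>"
      unfolding A.err_def by (rule A.dist_CE_le[OF X Zi])
    ultimately show "AE \<omega> in M. dist (A.CE (B.CE X) \<omega>) (A.CE X \<omega>) \<le> A.err X n \<omega> + A.err X n \<omega>"
      using simple[OF Z fin]
    proof eventually_elim
      case (elim \<omega>)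
      then show ?case
        using dist_triangle2[of "A.CE (B.CE X) \<omega>" "A.CE X \<omega>" "A.CE ?Z \<omega>"] by simp
    qed
  qed
qed

end

context cc_subalg
begin

text \<open>\<open>CE_K\<close> replaces the pair by its image under \<open>K\<close>, a barycentre
  of the points \<open>K v\<close> in which \<open>v\<close> receives \<open>\<xi>\<close> where
  \<open>X = v\<close> and \<open>1 - \<xi>\<close> where \<open>Y = v\<close>. Conditioning then
  acts on these weights, and the \<open>G\<close>-measurable \<open>\<xi>\<close> factors
  out.\<close>

lemma CE_cc_pair_simple:
  assumes X: "X \<in> borel_measurable M" "finite (X ` space M)"
    and Y: "Y \<in> borel_measurable M" "finite (Y ` space M)"
    and \<xi>: "\<xi> \<in> borel_measurable G" and \<xi>01: "\<And>\<omega>. \<omega> \<in> space M \<Longrightarrow> 0 < \<xi> \<omega> \<and> \<xi> \<omega> < 1"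
  shows "AE \<omega> in M. CE (\<lambda>\<omega>. cc [(\<xi> \<omega>, X \<omega>), (1 - \<xi> \<omega>, Y \<omega>)]) \<omega>
    = cc [(\<xi> \<omega>, CE X \<omega>), (1 - \<xi> \<omega>, CE Y \<omega>)]"
proof -
  define V where "V = X ` space M \<union> Y ` space M"
  have V: "finite V" "X ` space M \<subseteq> V" "Y ` space M \<subseteq> V" using X Y by (auto simp: V_def)
  note [measurable] = X(1) Y(1)
  have \<xi>M [measurable]: "\<xi> \<in> borel_measurable M" by (rule measurable_from_subalg[OF subalg \<xi>])
  let ?IX = "\<lambda>v. indicat_real (X -` {v} \<inter> space M)" and ?IY = "\<lambda>v. indicat_real (Y -` {v} \<inter> space M)"
  let ?W = "\<lambda>v \<omega>. \<xi> \<omega> * ?IX v \<omega> + (1 - \<xi> \<omega>) * ?IY v \<omega>"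
  let ?T = "\<lambda>\<omega>. cc [(\<xi> \<omega>, X \<omega>), (1 - \<xi> \<omega>, Y \<omega>)]"
  have Ti: "cc_integrable M ?T"
    by (rule cc_integrable_cc_pair[OF cc_integrable_finite[OF X] cc_integrable_finite[OF Y] \<xi>M \<xi>01])
  have Im [measurable]: "?IX v \<in> borel_measurable M" "?IY v \<in> borel_measurable M" for v by measurable
  have Wm: "?W v \<in> borel_measurable M" for v by measurable
  have delta: "bary V (\<lambda>v. indicat_real (Z -` {v} \<inter> space M) \<omega>) K = K (Z \<omega>)"
     "weights_on V (\<lambda>v. indicat_real (Z -` {v} \<inter> space M) \<omega>)"
    if "\<omega> \<in> space M" "Z ` space M \<subseteq> V" for Z \<omega>
  proof -
    have eq: "(\<lambda>v. indicat_real (Z -` {v} \<inter> space M) \<omega>) = (\<lambda>v. if v = Z \<omega> then 1 else 0)"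
      using that(1) by (auto simp: indicator_def)
    have "Z \<omega> \<in> V" using that by auto
    then show "bary V (\<lambda>v. indicat_real (Z -` {v} \<inter> space M) \<omega>) K = K (Z \<omega>)"
      "weights_on V (\<lambda>v. indicat_real (Z -` {v} \<inter> space M) \<omega>)"
      unfolding eq using bary_delta[OF V(1)] weights_on_delta[OF V(1)] by auto
  qed
  have KT: "K (?T \<omega>) = bary V (\<lambda>v. ?W v \<omega>) K" if \<omega>: "\<omega> \<in> space M" for \<omega>
    using cc_pair_bary[of "\<xi> \<omega>" V, OF _ _ delta(2)[OF \<omega> V(2)] delta(2)[OF \<omega> V(3)], of K] \<xi>01[OF \<omega>]
      delta(1)[OF \<omega> V(2)] delta(1)[OF \<omega> V(3)] by (simp add: K_cc_pair)
  have Ww: "weights_on V (\<lambda>v. ?W v \<omega>)" if \<omega>: "\<omega> \<in> space M" for \<omega>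
    using delta(2)[OF \<omega> V(2)] delta(2)[OF \<omega> V(3)] \<xi>01[OF \<omega>]
    by (auto simp: weights_on_def sum.distrib simp flip: sum_distrib_left)
  have "AE \<omega> in M. CE (\<lambda>\<omega>. K (?T \<omega>)) \<omega> = CE (\<lambda>\<omega>. bary V (\<lambda>v. ?W v \<omega>) K) \<omega>"
    by (intro CE_cong_AE cc_integrable_K Ti cc_integrable_bary V(1) Wm Ww K_K AE_I2 KT)
  moreover have "AE \<omega> in M. CE (\<lambda>\<omega>. bary V (\<lambda>v. ?W v \<omega>) K) \<omega> = bary V (\<lambda>v. RCE (?W v) \<omega>) K"
    by (intro CE_bary V(1) Wm Ww K_K)
  moreover have "AE \<omega> in M. \<forall>v\<in>V. RCE (?W v) \<omega> = \<xi> \<omega> * cprob X v \<omega> + (1 - \<xi> \<omega>) * cprob Y v \<omega>"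
  proof (intro AE_finite_allI V(1))
    fix v
    have int: "integrable M (\<lambda>\<omega>. \<xi> \<omega> * ?IX v \<omega>)" "integrable M (\<lambda>\<omega>. (1 - \<xi> \<omega>) * ?IY v \<omega>)"
      using \<xi>01 by (auto intro!: integrable_const_bound[where B = 1] AE_I2 simp: indicator_def abs_le_iff less_imp_le)
    have "AE \<omega> in M. RCE (?W v) \<omega> = RCE (\<lambda>\<omega>. \<xi> \<omega> * ?IX v \<omega>) \<omega> + RCE (\<lambda>\<omega>. (1 - \<xi> \<omega>) * ?IY v \<omega>) \<omega>"
      by (rule cond.real_cond_exp_add[OF int])
    moreover have "AE \<omega> in M. RCE (\<lambda>\<omega>. \<xi> \<omega> * ?IX v \<omega>) \<omega> = \<xi> \<omega> * cprob X v \<omega>"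
      unfolding cprob_def by (rule cond.real_cond_exp_mult[OF \<xi> Im(1) int(1)])
    moreover have "AE \<omega> in M. RCE (\<lambda>\<omega>. (1 - \<xi> \<omega>) * ?IY v \<omega>) \<omega> = (1 - \<xi> \<omega>) * cprob Y v \<omega>"
      unfolding cprob_def by (rule cond.real_cond_exp_mult[OF _ Im(2) int(2)]) (use \<xi> in measurable)
    ultimately show "AE \<omega> in M. RCE (?W v) \<omega> = \<xi> \<omega> * cprob X v \<omega> + (1 - \<xi> \<omega>) * cprob Y v \<omega>"
      by eventually_elim simp
  qed
  ultimately show ?thesis
    using CE_K[OF Ti] CE_simple[OF X] CE_simple[OF Y] SCE_AE_superset[OF X(1) V(1,2)]
      SCE_AE_superset[OF Y(1) V(1,3)] AE_space
  proof eventually_elim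
    case (elim \<omega>)
    have "CE ?T \<omega> = bary V (\<lambda>v. \<xi> \<omega> * cprob X v \<omega> + (1 - \<xi> \<omega>) * cprob Y v \<omega>) K"
      using elim(1-4) by (auto intro!: bary_cong)
    also have "\<dots> = cc [(\<xi> \<omega>, bary V (\<lambda>v. cprob X v \<omega>) K), (1 - \<xi> \<omega>, bary V (\<lambda>v. cprob Y v \<omega>) K)]"
      using elim \<xi>01[of \<omega>] by (intro cc_pair_bary[symmetric]) auto
    finally show ?case using elim by simp
  qed
qed

lemma CE_cc_pair:
  assumes X: "cc_integrable M X" and Y: "cc_integrable M Y"
    and \<xi>: "\<xi> \<in> borel_measurable G" and \<xi>01: "\<And>\<omega>. \<omega> \<in> space M \<Longrightarrow> 0 < \<xi> \<omega> \<and> \<xi> \<omega> < 1"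
  shows "AE \<omega> in M. CE (\<lambda>\<omega>. cc [(\<xi> \<omega>, X \<omega>), (1 - \<xi> \<omega>, Y \<omega>)]) \<omega>
    = cc [(\<xi> \<omega>, CE X \<omega>), (1 - \<xi> \<omega>, CE Y \<omega>)]"
proof (rule AE_eq_if_dist_tendsto)
  have \<xi>M: "\<xi> \<in> borel_measurable M" by (rule measurable_from_subalg[OF subalg \<xi>])
  \<comment> \<open>The sum of the two errors is paid twice: for \<open>CE\<close> of the pair, and
    for the pair formed from \<open>CE X\<close> and \<open>CE Y\<close>.\<close>
  show "AE \<omega> in M. (\<lambda>n. 2 * (err X n \<omega> + err Y n \<omega>)) \<longlonglongrightarrow> 0"
    using err_tendsto[OF X] err_tendsto[OF Y]
    by eventually_elim (intro tendsto_mult_right_zero tendsto_add_zero)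
  fix n
  let ?X = "\<lambda>\<omega>. discretize u n (X \<omega>)" and ?Y = "\<lambda>\<omega>. discretize u n (Y \<omega>)"
  note [measurable] = X[THEN cc_integrable_measurable] Y[THEN cc_integrable_measurable]
  have Xm: "?X \<in> borel_measurable M" and Ym: "?Y \<in> borel_measurable M" by measurable
  have Xi: "cc_integrable M ?X" and Yi: "cc_integrable M ?Y"
    by (intro cc_integrable_discretize cc_integrable_measurable X Y)+
  let ?T = "\<lambda>\<omega>. cc [(\<xi> \<omega>, X \<omega>), (1 - \<xi> \<omega>, Y \<omega>)]" and ?T' = "\<lambda>\<omega>. cc [(\<xi> \<omega>, ?X \<omega>), (1 - \<xi> \<omega>, ?Y \<omega>)]"
  have Ti: "cc_integrable M ?T" by (rule cc_integrable_cc_pair[OF X Y \<xi>M \<xi>01])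
  have Ti': "cc_integrable M ?T'" by (rule cc_integrable_cc_pair[OF Xi Yi \<xi>M \<xi>01])
  have pair: "dist (cc [(l, a), (1 - l, b)]) (cc [(l, a'), (1 - l, b')]) \<le> dist a a' + dist b b'"
    if "0 < l \<and> l < 1" for l and a b a' b' :: 'a
  proof -
    have "dist (cc [(l, a), (1 - l, b)]) (cc [(l, a'), (1 - l, b')]) \<le> l * dist a a' + (1 - l) * dist b b'"
      using that by (intro cc_dist) auto
    also have "\<dots> \<le> 1 * dist a a' + 1 * dist b b'"
      using that by (intro add_mono mult_right_mono) auto
    finally show ?thesis by simp
  qed
  have "AE \<omega> in M. RCE (\<lambda>\<omega>. dist (?T \<omega>) (?T' \<omega>)) \<omega> \<le> err X n \<omega> + err Y n \<omega>"
    unfolding err_def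
    by (intro RCE_le_add cc_integrable_dist Ti Ti' X Y Xi Yi AE_I2 pair \<xi>01)
  moreover have "AE \<omega> in M. CE ?T' \<omega> = cc [(\<xi> \<omega>, CE ?X \<omega>), (1 - \<xi> \<omega>, CE ?Y \<omega>)]"
    by (rule CE_cc_pair_simple[OF Xm finite_discretize Ym finite_discretize \<xi> \<xi>01])
  moreover have "AE \<omega> in M. dist (CE X \<omega>) (CE ?X \<omega>) \<le> err X n \<omega>"
    unfolding err_def by (rule dist_CE_le[OF X Xi])
  moreover have "AE \<omega> in M. dist (CE Y \<omega>) (CE ?Y \<omega>) \<le> err Y n \<omega>"
    unfolding err_def by (rule dist_CE_le[OF Y Yi])
  ultimately show "AE \<omega> in M. dist (CE ?T \<omega>) (cc [(\<xi> \<omega>, CE X \<omega>), (1 - \<xi> \<omega>, CE Y \<omega>)])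
      \<le> 2 * (err X n \<omega> + err Y n \<omega>)"
    using dist_CE_le[OF Ti Ti'] AE_space
  proof eventually_elim
    case (elim \<omega>)
    then show ?case
      using dist_triangle2[of "CE ?T \<omega>" "cc [(\<xi> \<omega>, CE X \<omega>), (1 - \<xi> \<omega>, CE Y \<omega>)]" "CE ?T' \<omega>"]
        pair[OF \<xi>01, of \<omega> "CE X \<omega>" "CE Y \<omega>" "CE ?X \<omega>" "CE ?Y \<omega>"] by simp
  qed
qed

section \<open>Independence and the unconditional expectation\<close>

lemma RCE_indep:
  assumes B: "B \<in> sets M" and indep: "\<And>A. A \<in> sets G \<Longrightarrow> prob (A \<inter> B) = prob A * prob B"
  shows "AE \<omega> in M. RCE (indicator B) \<omega> = prob B"
proof (rule cond.real_cond_exp_charact)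
  fix A assume A: "A \<in> sets G"
  then have AM: "A \<in> sets M" using subalg by (auto simp: subalgebra_def)
  have "(LINT \<omega>:A|M. indicat_real B \<omega>) = (LINT \<omega>|M. indicat_real (A \<inter> B) \<omega>)"
    by (simp add: set_lebesgue_integral_def indicator_inter_arith)
  also have "\<dots> = prob (A \<inter> B)" using AM B by simp
  also have "\<dots> = (LINT \<omega>:A|M. prob B)"
    using indep[OF A] AM by (simp add: set_lebesgue_integral_def)
  finally show "(LINT \<omega>:A|M. indicat_real B \<omega>) = (LINT \<omega>:A|M. prob B)" .
qed (use B in \<open>auto simp: less_top[symmetric]\<close>)

text \<open>Independence turns the conditional probability of each level set into its probability,
  so the approximating sequences already agree before the limit. The hypothesis is the bare product
  rule, which can be checked directly for the trivial \<sigma>-algebra in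
  \<open>expectation_CE\<close>.\<close>

lemma CE_indep:
  assumes X: "cc_integrable M X"
    and indep: "\<And>A S. A \<in> sets G \<Longrightarrow> S \<in> sets borel \<Longrightarrow>
      prob (A \<inter> (X -` S \<inter> space M)) = prob A * prob (X -` S \<inter> space M)"
  shows "AE \<omega> in M. CE X \<omega> = cc_expectation cc u M X"
proof -
  note Xm [measurable] = cc_integrable_measurable[OF X]
  have "AE \<omega> in M. SCE (\<lambda>\<omega>. discretize u n (X \<omega>)) \<omega> = simple_expectation cc M (\<lambda>\<omega>. discretize u n (X \<omega>))"
    for n
  proof -
    let ?Z = "\<lambda>\<omega>. discretize u n (X \<omega>)"
    have Z: "?Z \<in> borel_measurable M" by measurable
    let ?V = "?Z ` space M"
    have fin: "finite ?V" by (rule finite_discretize)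
    have "AE \<omega> in M. \<forall>v\<in>?V. cprob ?Z v \<omega> = prob (?Z -` {v} \<inter> space M)"
      unfolding cprob_def
    proof (intro AE_finite_allI fin RCE_indep)
      fix v
      show "?Z -` {v} \<inter> space M \<in> sets M" by measurable
      have "?Z -` {v} \<inter> space M = X -` (discretize u n -` {v}) \<inter> space M" by auto
      moreover have "discretize u n -` {v} \<in> sets borel"
        using measurable_sets[OF measurable_discretize, of "{v}" u n] by simp
      ultimately show "prob (A \<inter> (?Z -` {v} \<inter> space M)) = prob A * prob (?Z -` {v} \<inter> space M)"
        if "A \<in> sets G" for A
        using indep[OF that] by simp
    qed
    then show ?thesis
      using SCE_AE_superset[OF Z fin order_refl]
    proof eventually_elim
      case (elim \<omega>)
      have w: "weights_on ?V (\<lambda>v. prob (?Z -` {v} \<inter> space M))"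
      proof -
        have "(\<Sum>v\<in>?V. prob (?Z -` {v} \<inter> space M)) = (\<Sum>v\<in>?V. cprob ?Z v \<omega>)"
          using elim(1) by (intro sum.cong) auto
        then show ?thesis using elim(3) by (simp add: weights_on_def)
      qed
      have "SCE ?Z \<omega> = bary ?V (\<lambda>v. prob (?Z -` {v} \<inter> space M)) K"
        using elim(1,2) by (auto intro!: bary_cong)
      also have "\<dots> = simple_expectation cc M ?Z"
        using cc0_eq_bary[OF simple_values(1)[OF fin], of "\<lambda>v. prob (?Z -` {v} \<inter> space M)" K] w
        unfolding simple_values(2)[OF fin] simple_expectation_def by simp
      finally show ?case .
    qed
  qed
  then have "AE \<omega> in M. \<forall>n. SCE (\<lambda>\<omega>. discretize u n (X \<omega>)) \<omega> = simple_expectation cc M (\<lambda>\<omega>. discretize u n (X \<omega>))"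
    by (simp add: AE_all_countable)
  with SCE_tendsto_CE[OF X] show ?thesis
    unfolding cc_expectation_def by eventually_elim (auto intro: limI[symmetric])
qed

end

context cc_prob
begin

text \<open>Every random element is independent of the trivial \<sigma>-algebra, so
  \<open>CE_indep\<close> makes its conditional expectation there the constant expectation, and the
  tower property compares two constants.\<close>

lemma expectation_CE:
  assumes G: "subalgebra M G" and X: "cc_integrable M X"
  shows "cc_expectation cc u M (cc_cond_expectation cc u M G X) = cc_expectation cc u M X"
proof -
  let ?T = "sigma (space M) {}"
  have T: "sets ?T = {{}, space M}" by (simp add: sigma_sets_empty_eq)
  have TM: "subalgebra M ?T" by (auto simp: subalgebra_def T)
  interpret A: cc_subalg cc M u ?T by unfold_locales (rule TM)
  interpret B: cc_subalg cc M u G by unfold_locales (rule G)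
  have triv: "AE \<omega> in M. A.CE Z \<omega> = cc_expectation cc u M Z" if "cc_integrable M Z" for Z
  proof (rule A.CE_indep[OF that])
    show "prob (A \<inter> (Z -` S \<inter> space M)) = prob A * prob (Z -` S \<inter> space M)" if "A \<in> sets ?T" for A S
      using that unfolding T by (auto simp: prob_space Int_absorb1)
  qed
  have "sets ?T \<subseteq> sets G"
    using G unfolding T by (auto simp: subalgebra_def dest: sym)
  then have "AE \<omega> in M. A.CE (B.CE X) \<omega> = A.CE X \<omega>"
    by (rule CE_tower[OF G TM _ X])
  then have "AE \<omega> in M. cc_expectation cc u M (B.CE X) = cc_expectation cc u M X"
    using triv[OF X] triv[OF B.cc_integrable_CE[OF X]] by eventually_elim simp
  \<comment> \<open>Almost sure equality of two constants is equality, since the whole space has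
    probability 1.\<close>
  then show ?thesis by simp
qed

end

theorem proposition4p10:
  fixes cc :: "(real \<times> 'a::polish_space) list \<Rightarrow> 'a"
    and u :: "nat \<Rightarrow> 'a"
    and M G :: "'w measure"
    and X Y :: "'w \<Rightarrow> 'a"
  assumes "cc_space cc"
    and "u 0 \<in> range (cc_convexify cc)"
    and "closure (u ` {1..}) = UNIV"
    and "prob_space M" and "complete_measure M" and "atomless M"
    and "cc_integrable M X" and "cc_integrable M Y"
    and "subalgebra M G"
  shows "cc_expectation cc u M (cc_cond_expectation cc u M G X) = cc_expectation cc u M X
    \<and> (prob_space.indep_set M (sets (vimage_algebra (space M) X borel)) (sets G) \<longrightarrow>
         (AE \<omega> in M. cc_cond_expectation cc u M G X \<omega> = cc_expectation cc u M X))
    \<and> (X \<in> borel_measurable G \<longrightarrow>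
         (AE \<omega> in M. cc_cond_expectation cc u M G X \<omega> = cc_convexify cc (X \<omega>)))
    \<and> (\<forall>\<xi> :: 'w \<Rightarrow> real. \<xi> \<in> borel_measurable G \<and> (\<forall>\<omega>\<in>space M. 0 < \<xi> \<omega> \<and> \<xi> \<omega> < 1) \<longrightarrow>
         (AE \<omega> in M. cc_cond_expectation cc u M G (\<lambda>\<omega>. cc [(\<xi> \<omega>, X \<omega>), (1 - \<xi> \<omega>, Y \<omega>)]) \<omega>
            = cc [(\<xi> \<omega>, cc_cond_expectation cc u M G X \<omega>),
                  (1 - \<xi> \<omega>, cc_cond_expectation cc u M G Y \<omega>)]))
    \<and> (\<forall>l :: real. 0 < l \<and> l < 1 \<longrightarrow>
         (AE \<omega> in M. cc_cond_expectation cc u M G (\<lambda>\<omega>. cc [(l, X \<omega>), (1 - l, Y \<omega>)]) \<omega>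
            = cc [(l, cc_cond_expectation cc u M G X \<omega>), (1 - l, cc_cond_expectation cc u M G Y \<omega>)]))
    \<and> (\<forall>G\<^sub>1 G\<^sub>2. subalgebra M G\<^sub>1 \<and> subalgebra M G\<^sub>2 \<and> sets G\<^sub>1 \<subseteq> sets G\<^sub>2 \<longrightarrow>
         (AE \<omega> in M.
            cc_cond_expectation cc u M G\<^sub>2 (cc_cond_expectation cc u M G\<^sub>1 X) \<omega>
              = cc_cond_expectation cc u M G\<^sub>1 (cc_cond_expectation cc u M G\<^sub>2 X) \<omega>
            \<and> cc_cond_expectation cc u M G\<^sub>1 (cc_cond_expectation cc u M G\<^sub>2 X) \<omega>
              = cc_cond_expectation cc u M G\<^sub>1 X \<omega>))"
proof -
  interpret cc_space cc by fact
  interpret prob_space M by fact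
  interpret cc_prob cc M u
    by unfold_locales (use assms(2,3) in auto)
  interpret cc_subalg cc M u G by unfold_locales fact
  note X = \<open>cc_integrable M X\<close> and Y = \<open>cc_integrable M Y\<close>
  have "AE \<omega> in M. CE X \<omega> = cc_expectation cc u M X"
    if indep: "indep_set (sets (vimage_algebra (space M) X borel)) (sets G)"
  proof (rule CE_indep[OF X])
    fix A and S :: "'a set" assume "A \<in> sets G" "S \<in> sets borel"
    then show "prob (A \<inter> (X -` S \<inter> space M)) = prob A * prob (X -` S \<inter> space M)"
      using indep_setD[OF indep in_vimage_algebra, of S A] by (simp add: Int_commute mult.commute)
  qed
  moreover have "AE \<omega> in M.
      cc_cond_expectation cc u M G\<^sub>2 (cc_cond_expectation cc u M G\<^sub>1 X) \<omega>
        = cc_cond_expectation cc u M G\<^sub>1 (cc_cond_expectation cc u M G\<^sub>2 X) \<omega>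
      \<and> cc_cond_expectation cc u M G\<^sub>1 (cc_cond_expectation cc u M G\<^sub>2 X) \<omega>
        = cc_cond_expectation cc u M G\<^sub>1 X \<omega>"
    if "subalgebra M G\<^sub>1" "subalgebra M G\<^sub>2" "sets G\<^sub>1 \<subseteq> sets G\<^sub>2" for G\<^sub>1 G\<^sub>2
  proof -
    interpret A: cc_subalg cc M u G\<^sub>1 by unfold_locales fact
    interpret B: cc_subalg cc M u G\<^sub>2 by unfold_locales fact
    have "subalgebra G\<^sub>2 G\<^sub>1" using that by (simp add: subalgebra_def)
    \<comment> \<open>Measurability passes to the larger \<sigma>-algebra, so
      \<open>CE_measurable\<close> evaluates the outer conditional expectation as
      \<open>K (A.CE X \<omega>)\<close>, and \<open>K\<close> fixes the values of
      \<open>A.CE X\<close>.\<close>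
    then have "A.CE X \<in> borel_measurable G\<^sub>2"
      by (rule measurable_from_subalg[OF _ A.measurable_CE])
    from B.CE_measurable[OF A.cc_integrable_CE[OF X] this] CE_tower[OF that(2,1,3) X] show ?thesis
      by eventually_elim simp
  qed
  ultimately show ?thesis
    \<comment> \<open>The combination with a fixed \<open>l\<close> is the case of a constant
      \<open>\<xi>\<close> in \<open>CE_cc_pair\<close>.\<close>
    using expectation_CE[OF \<open>subalgebra M G\<close> X] CE_measurable[OF X] CE_cc_pair[OF X Y]
    by (intro conjI allI impI) auto
qed

end
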